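(* Let $M\subseteq\mathbb{D}^d$ be a constructible set, let $(X,d)$ be either $(\mathbb{I},d_2)$ or $(\Theta,d_g)$, and let $A\subseteq\mathbb{S}^{d-1}$ be the set of directions at which the persistent homology transform of $M$ is sampled. For every direction $w\in\mathbb{S}^{d-1}$, every homological degree $n$, and every $v\in A$, there exists an $\epsilon$-interleaving with $\epsilon=2d(v,w)$ between the $X$-persistence modules $\mathrm{PHT}^X_n(M)(w)$ and $\overline{\mathrm{PHT}}^X_n(M)(w)$, where $\overline{\mathrm{PHT}}^X_n(M)$ is the (left, right, or center) Kan extension of $\mathrm{PHT}^X_n(M)$ from $A$.
   Context: Fix a field $\Bbbk$; $\mathrm{Vect}$ is the category of $\Bbbk$-vector spaces and $H_n$ is homology with coefficients in $\Bbbk$. Fix an o-minimal structure $\mathcal{O}=\{\mathcal{O}_d\}$: for each $d\ge 0$ a boolean algebra $\mathcal{O}_d$ of subsets of $\mathbb{R}^d$, with $\mathcal{O}_1$ consisting only of finite unions of points and intervals, closed under $A\mapsto A\times\mathbb{R},\ \mathbb{R}\times A$ and under axis-aligned projections $\mathbb{R}^{d+1}\to\mathbb{R}^d$, and containing all semialgebraic sets. A constructible set is a compact member of some $\mathcal{O}_d$. $\mathbb{D}^d$ is the closed unit ball in $\mathbb{R}^d$, $\mathbb{S}^{d-1}$ the unit sphere. For $v\in\mathbb{S}^{d-1}$, $t\in\mathbb{R}$, put $M_{v,t}=\{x\in M: x\cdot v\le t\}$. $\mathbb{I}=[-1,1]$, $\Theta=[-\pi,0]$; $d_2(v,w)=\|v-w\|_2$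 and $d_g(v,w)=\arccos(v\cdot w)$ on $\mathbb{S}^{d-1}$. The interval $X$ is viewed as a category via $\le$, and $\mathrm{Vect}^X$ is the category of functors $X\to\mathrm{Vect}$ ($X$-persistence modules). The persistent homology transform $\mathrm{PHT}^X_n(M):\mathbb{S}^{d-1}\to\mathrm{Vect}^X$ is given by $\mathrm{PHT}^{\mathbb{I}}_n(M)(v)(t)=H_n(M_{v,t})$ and $\mathrm{PHT}^{\Theta}_n(M)(v)(\theta)=H_n(M_{v,\cos\theta})$, with maps induced by inclusions. Interleavings: for $\varepsilon\ge0$ let $T_\varepsilon:X\to X$, $T_\varepsilon(x)=\min(x+\varepsilon,\sup X)$. An $\varepsilon$-interleaving between $U,V\in\mathrm{Vect}^X$ is a pair of natural transformations $\Phi:U\Rightarrow VT_\varepsilon$, $\Psi:V\Rightarrow UT_\varepsilon$ with $(\Psi T_\varepsilon)\Phi=U\sigma_{2\varepsilon}$ and $(\Phi T_\varepsilon)\Psi=V\sigma_{2\varepsilon}$, where $\sigma_{2\varepsilon}:\mathrm{Id}\Rightarrow T_{2\varepsilon}$ is the canonical natural transformation. Space-time category: $\mathbb{AX}$ is the pre-order category with object set $A\times X$ and a unique morphism $(v,\alpha)\to(w,\beta)$ exactly when $\alpha+d(v,w)\le\beta$ or $\beta=\sup X$. Whenever such a morphism exists, the sublevel set of $M$ at $(v,\alpha)$ is contained in that at $(w,\beta)$, so $G(v,\alpha)=\mathrm{PHT}^X_n(M)(v)(\alpha)$ with inclusion-induced maps is a functor $G:\mathbb{AX}\to\mathrm{Vect}$.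 $\mathbb{S}^{d-1}\mathbb{X}$ is this category for $A=\mathbb{S}^{d-1}$. Kan extensions: for $(w,\beta)\in\mathbb{S}^{d-1}\mathbb{X}$, the left Kan extension is $\mathrm{Lan}(w,\beta)=\operatorname{colim} G(v,\alpha)$ over the full subcategory of $(v,\alpha)\in\mathbb{AX}$ admitting a morphism $(v,\alpha)\to(w,\beta)$; the right Kan extension is $\mathrm{Ran}(w,\beta)=\lim G(v,\alpha)$ over the full subcategory of $(v,\alpha)\in\mathbb{AX}$ admitting a morphism $(w,\beta)\to(v,\alpha)$; the center Kan extension assigns to $(w,\beta)$ the image of the canonical map $\mathrm{Lan}(w,\beta)\to\mathrm{Ran}(w,\beta)$ (induced by the universal properties from the maps of $G$ on composites $(v,\alpha)\to(w,\beta)\to(v',\alpha')$). For any one of these choices $\hat G$, $\overline{\mathrm{PHT}}^X_n(M)(w)=\hat G(w,\cdot)$. *)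

theory Defs
  imports "HOL-Analysis.Analysis" "HOL-Homology.Homology" "Jordan_Normal_Form.Missing_VectorSpace"
begin

text \<open>
  Throughout, \<open>\<real>\<^sup>d\<close> is the carrier of \<^const>\<open>Euclidean_space\<close> \<open>d\<close>: the maps \<open>x :: nat \<Rightarrow> real\<close>
  with \<open>x i = 0\<close> for all \<open>i \<ge> d\<close>. The category \<open>Vect\<close> over a field \<open>K\<close> consists of the
  \<^const>\<open>vectorspace\<close> and \<^const>\<open>linear_map\<close> locales; the ring operations \<open>mult\<close> and \<open>one\<close>
  that every module record carries play no role and are left undefined.
\<close>

section \<open>O-minimal structures and constructible sets\<close>

abbreviation real_space :: "nat \<Rightarrow> (nat \<Rightarrow> real) set" where
  "real_space d \<equiv> topspace (Euclidean_space d)"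

inductive_set polynomial_maps :: "nat \<Rightarrow> ((nat \<Rightarrow> real) \<Rightarrow> real) set" for d :: nat where
  const: "(\<lambda>x. c) \<in> polynomial_maps d"
| coord: "i < d \<Longrightarrow> (\<lambda>x. x i) \<in> polynomial_maps d"
| add: "\<lbrakk>p \<in> polynomial_maps d; q \<in> polynomial_maps d\<rbrakk> \<Longrightarrow> (\<lambda>x. p x + q x) \<in> polynomial_maps d"
| mult: "\<lbrakk>p \<in> polynomial_maps d; q \<in> polynomial_maps d\<rbrakk> \<Longrightarrow> (\<lambda>x. p x * q x) \<in> polynomial_maps d"

inductive semialgebraic :: "nat \<Rightarrow> (nat \<Rightarrow> real) set \<Rightarrow> bool" for d :: nat where
  pos: "p \<in> polynomial_maps d \<Longrightarrow> semialgebraic d {x \<in> real_space d. p x > 0}"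
| compl: "semialgebraic d A \<Longrightarrow> semialgebraic d (real_space d - A)"
| union: "\<lbrakk>semialgebraic d A; semialgebraic d B\<rbrakk> \<Longrightarrow> semialgebraic d (A \<union> B)"

text \<open>For \<open>k \<le> d\<close> this is the axis-aligned projection \<open>\<real>\<^sup>d\<^sup>+\<^sup>1 \<rightarrow> \<real>\<^sup>d\<close> forgetting coordinate \<open>k\<close>.\<close>

definition drop_coord :: "nat \<Rightarrow> (nat \<Rightarrow> real) \<Rightarrow> nat \<Rightarrow> real" where
  "drop_coord k x = (\<lambda>i. if i < k then x i else x (Suc i))"

text \<open>
  In \<open>tame\<close>, \<open>\<real>\<^sup>1\<close> is identified with \<open>\<real>\<close> through the coordinate \<open>x 0\<close>; \<^const>\<open>is_interval\<close>
  includes singletons and unbounded intervals. The sets in \<open>cylinder_right\<close> and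
  \<open>cylinder_left\<close> are \<open>A \<times> \<real>\<close> and \<open>\<real> \<times> A\<close>.
\<close>

locale o_minimal =
  fixes \<O> :: "nat \<Rightarrow> (nat \<Rightarrow> real) set set"
  assumes boolean_algebra: "Sigma_Algebra.algebra (real_space d) (\<O> d)"
    and tame: "A \<in> \<O> 1 \<Longrightarrow>
      \<exists>F. finite F \<and> (\<forall>J \<in> F. is_interval J) \<and> (\<lambda>x. x 0) ` A = \<Union>F"
    and cylinder_right: "A \<in> \<O> d \<Longrightarrow> {x \<in> real_space (Suc d). drop_coord d x \<in> A} \<in> \<O> (Suc d)"
    and cylinder_left: "A \<in> \<O> d \<Longrightarrow> {x \<in> real_space (Suc d). drop_coord 0 x \<in> A} \<in> \<O> (Suc d)"
    and projection: "\<lbrakk>A \<in> \<O> (Suc d); k \<le> d\<rbrakk> \<Longrightarrow> drop_coord k ` A \<in> \<O> d"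
    and semialgebraic: "semialgebraic d A \<Longrightarrow> A \<in> \<O> d"

definition constructible :: "(nat \<Rightarrow> (nat \<Rightarrow> real) set set) \<Rightarrow> nat \<Rightarrow> (nat \<Rightarrow> real) set \<Rightarrow> bool" where
  "constructible \<O> d M \<longleftrightarrow> M \<in> \<O> d \<and> compactin (Euclidean_space d) M"


section \<open>Directions, metrics and sublevel sets\<close>

definition dot :: "nat \<Rightarrow> (nat \<Rightarrow> real) \<Rightarrow> (nat \<Rightarrow> real) \<Rightarrow> real" where
  "dot d x y = (\<Sum>i<d. x i * y i)"

definition unit_ball :: "nat \<Rightarrow> (nat \<Rightarrow> real) set" where
  "unit_ball d = {x \<in> real_space d. L2_set x {..<d} \<le> 1}"

definition unit_sphere :: "nat \<Rightarrow> (nat \<Rightarrow> real) set" where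
  "unit_sphere d = {x \<in> real_space d. L2_set x {..<d} = 1}"

definition dist_l2 :: "nat \<Rightarrow> (nat \<Rightarrow> real) \<Rightarrow> (nat \<Rightarrow> real) \<Rightarrow> real" where
  "dist_l2 d v w = L2_set (\<lambda>i. v i - w i) {..<d}"

definition dist_geo :: "nat \<Rightarrow> (nat \<Rightarrow> real) \<Rightarrow> (nat \<Rightarrow> real) \<Rightarrow> real" where
  "dist_geo d v w = arccos (dot d v w)"

definition sublevel :: "nat \<Rightarrow> (nat \<Rightarrow> real) set \<Rightarrow> (nat \<Rightarrow> real) \<Rightarrow> real \<Rightarrow> (nat \<Rightarrow> real) topology" where
  "sublevel d M v t = subtopology (Euclidean_space d) {x \<in> M. dot d x v \<le> t}"


section \<open>Constructions with vector spaces\<close>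

definition quotient_space :: "('k, 'v) module \<Rightarrow> 'v set \<Rightarrow> ('k, 'v set) module" where
  "quotient_space V W =
    \<lparr>carrier = a_rcosets\<^bsub>V\<^esub> W, mult = undefined, one = undefined, zero = W, add = set_add V,
     smult = (\<lambda>c C. \<Union>x\<in>C. W +>\<^bsub>V\<^esub> (c \<odot>\<^bsub>V\<^esub> x))\<rparr>"

definition family_prod :: "'i set \<Rightarrow> ('i \<Rightarrow> ('k, 'v) module) \<Rightarrow> ('k, 'i \<Rightarrow> 'v) module" where
  "family_prod I V =
    \<lparr>carrier = (\<Pi>\<^sub>E i\<in>I. carrier (V i)), mult = undefined, one = undefined,
     zero = (\<lambda>i\<in>I. \<zero>\<^bsub>V i\<^esub>), add = (\<lambda>f g. \<lambda>i\<in>I. f i \<oplus>\<^bsub>V i\<^esub> g i),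
     smult = (\<lambda>c f. \<lambda>i\<in>I. c \<odot>\<^bsub>V i\<^esub> f i)\<rparr>"

definition family_sum :: "'i set \<Rightarrow> ('i \<Rightarrow> ('k, 'v) module) \<Rightarrow> ('k, 'i \<Rightarrow> 'v) module" where
  "family_sum I V = (family_prod I V)
    \<lparr>carrier := {f \<in> carrier (family_prod I V). finite {i \<in> I. f i \<noteq> \<zero>\<^bsub>V i\<^esub>}}\<rparr>"

definition family_inj :: "'i set \<Rightarrow> ('i \<Rightarrow> ('k, 'v) module) \<Rightarrow> 'i \<Rightarrow> 'v \<Rightarrow> 'i \<Rightarrow> 'v" where
  "family_inj I V i x = (\<lambda>j\<in>I. if j = i then x else \<zero>\<^bsub>V j\<^esub>)"

definition free_space :: "('k, 'm) ring_scheme \<Rightarrow> 's set \<Rightarrow> ('k, 's \<Rightarrow> 'k) module" where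
  "free_space K S = (ring.func_space K S)
    \<lparr>carrier := {f \<in> S \<rightarrow>\<^sub>E carrier K. finite {s \<in> S. f s \<noteq> \<zero>\<^bsub>K\<^esub>}}\<rparr>"

definition basis_vec :: "('k, 'm) ring_scheme \<Rightarrow> 's set \<Rightarrow> 's \<Rightarrow> 's \<Rightarrow> 'k" where
  "basis_vec K S s = (\<lambda>t\<in>S. if t = s then \<one>\<^bsub>K\<^esub> else \<zero>\<^bsub>K\<^esub>)"

definition lin_extend ::
  "('k, 'm) ring_scheme \<Rightarrow> 's set \<Rightarrow> ('k, 'v) module \<Rightarrow> ('s \<Rightarrow> 'v) \<Rightarrow> ('s \<Rightarrow> 'k) \<Rightarrow> 'v" where
  "lin_extend K S V b f = (\<Oplus>\<^bsub>V\<^esub> s \<in> {s \<in> S. f s \<noteq> \<zero>\<^bsub>K\<^esub>}. f s \<odot>\<^bsub>V\<^esub> b s)"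


section \<open>Singular homology with coefficients in a field\<close>

text \<open>
  The library's singular homology has integer coefficients only. The following repeats it over \<open>K\<close>,
  with the library's singular simplices, faces and \<^const>\<open>simplex_map\<close>.
\<close>

type_synonym 'a sing = "(nat \<Rightarrow> real) \<Rightarrow> 'a"

definition chain_space ::
  "('k, 'm) ring_scheme \<Rightarrow> nat \<Rightarrow> 'a topology \<Rightarrow> ('k, 'a sing \<Rightarrow> 'k) module" where
  "chain_space K p X = free_space K (singular_simplex_set p X)"

definition boundary ::
  "('k, 'm) ring_scheme \<Rightarrow> nat \<Rightarrow> 'a topology \<Rightarrow> ('a sing \<Rightarrow> 'k) \<Rightarrow> 'a sing \<Rightarrow> 'k" where
  "boundary K p X =
    (if p = 0 then (\<lambda>c. \<zero>\<^bsub>chain_space K 0 X\<^esub>)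
     else lin_extend K (singular_simplex_set p X) (chain_space K (p - 1) X)
       (\<lambda>s. \<Oplus>\<^bsub>chain_space K (p - 1) X\<^esub> k \<in> {..p}. ((\<ominus>\<^bsub>K\<^esub> \<one>\<^bsub>K\<^esub>) [^]\<^bsub>K\<^esub> k) \<odot>\<^bsub>chain_space K (p - 1) X\<^esub>
          basis_vec K (singular_simplex_set (p - 1) X) (singular_face p k s)))"

definition cycle_space ::
  "('k, 'm) ring_scheme \<Rightarrow> nat \<Rightarrow> 'a topology \<Rightarrow> ('k, 'a sing \<Rightarrow> 'k) module" where
  "cycle_space K p X = (chain_space K p X)
    \<lparr>carrier := {c \<in> carrier (chain_space K p X). boundary K p X c = \<zero>\<^bsub>chain_space K (p - 1) X\<^esub>}\<rparr>"

definition boundary_space ::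
  "('k, 'm) ring_scheme \<Rightarrow> nat \<Rightarrow> 'a topology \<Rightarrow> ('a sing \<Rightarrow> 'k) set" where
  "boundary_space K p X = boundary K (Suc p) X ` carrier (chain_space K (Suc p) X)"

definition homology ::
  "('k, 'm) ring_scheme \<Rightarrow> nat \<Rightarrow> 'a topology \<Rightarrow> ('k, ('a sing \<Rightarrow> 'k) set) module" where
  "homology K p X = quotient_space (cycle_space K p X) (boundary_space K p X)"

definition chain_push ::
  "('k, 'm) ring_scheme \<Rightarrow> nat \<Rightarrow> 'a topology \<Rightarrow> 'b topology \<Rightarrow> ('a \<Rightarrow> 'b) \<Rightarrow>
   ('a sing \<Rightarrow> 'k) \<Rightarrow> 'b sing \<Rightarrow> 'k" where
  "chain_push K p X Y g = lin_extend K (singular_simplex_set p X) (chain_space K p Y)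
    (\<lambda>s. basis_vec K (singular_simplex_set p Y) (simplex_map p g s))"

definition homology_map ::
  "('k, 'm) ring_scheme \<Rightarrow> nat \<Rightarrow> 'a topology \<Rightarrow> 'b topology \<Rightarrow> ('a \<Rightarrow> 'b) \<Rightarrow>
   ('a sing \<Rightarrow> 'k) set \<Rightarrow> ('b sing \<Rightarrow> 'k) set" where
  "homology_map K p X Y g C =
    (\<Union>c\<in>C. boundary_space K p Y +>\<^bsub>cycle_space K p Y\<^esub> chain_push K p X Y g c)"


section \<open>Functors from a preorder to vector spaces\<close>

text \<open>
  A functor from a preorder \<open>(I, R)\<close> to \<open>Vect\<close> is given by its objects and, for \<open>R i j\<close>, the map
  \<open>arr D i j\<close>. Only the values at elements of \<open>I\<close>, at related pairs, and on carriers are meaningful.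
\<close>

record ('i, 'k, 'v) diagram =
  ob :: "'i \<Rightarrow> ('k, 'v) module"
  arr :: "'i \<Rightarrow> 'i \<Rightarrow> 'v \<Rightarrow> 'v"

definition vect_functor ::
  "('k, 'm) ring_scheme \<Rightarrow> 'i set \<Rightarrow> ('i \<Rightarrow> 'i \<Rightarrow> bool) \<Rightarrow> ('i, 'k, 'v) diagram \<Rightarrow> bool" where
  "vect_functor K I R D \<longleftrightarrow>
    (\<forall>i\<in>I. vectorspace K (ob D i)) \<and>
    (\<forall>i\<in>I. \<forall>j\<in>I. R i j \<longrightarrow> linear_map K (ob D i) (ob D j) (arr D i j)) \<and>
    (\<forall>i\<in>I. \<forall>x \<in> carrier (ob D i). arr D i i x = x) \<and>
    (\<forall>i\<in>I. \<forall>j\<in>I. \<forall>k\<in>I. R i j \<longrightarrow> R j k \<longrightarrow>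
      (\<forall>x \<in> carrier (ob D i). arr D j k (arr D i j x) = arr D i k x))"

definition nat_trans ::
  "('k, 'm) ring_scheme \<Rightarrow> 'i set \<Rightarrow> ('i \<Rightarrow> 'i \<Rightarrow> bool) \<Rightarrow> ('i, 'k, 'u) diagram \<Rightarrow>
   ('i, 'k, 'v) diagram \<Rightarrow> ('i \<Rightarrow> 'u \<Rightarrow> 'v) \<Rightarrow> bool" where
  "nat_trans K I R U V \<Phi> \<longleftrightarrow>
    (\<forall>i\<in>I. linear_map K (ob U i) (ob V i) (\<Phi> i)) \<and>
    (\<forall>i\<in>I. \<forall>j\<in>I. R i j \<longrightarrow>
      (\<forall>x \<in> carrier (ob U i). \<Phi> j (arr U i j x) = arr V i j (\<Phi> i x)))"

definition precompose :: "('i, 'k, 'v) diagram \<Rightarrow> ('j \<Rightarrow> 'i) \<Rightarrow> ('j, 'k, 'v) diagram" where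
  "precompose D f = \<lparr>ob = (\<lambda>j. ob D (f j)), arr = (\<lambda>j k. arr D (f j) (f k))\<rparr>"

definition colim_relations ::
  "('k, 'm) ring_scheme \<Rightarrow> 'i set \<Rightarrow> ('i \<Rightarrow> 'i \<Rightarrow> bool) \<Rightarrow> ('i, 'k, 'v) diagram \<Rightarrow> ('i \<Rightarrow> 'v) set" where
  "colim_relations K I R D = module.span K (family_sum I (ob D))
    {family_inj I (ob D) i x \<ominus>\<^bsub>family_sum I (ob D)\<^esub> family_inj I (ob D) j (arr D i j x) | i j x.
      i \<in> I \<and> j \<in> I \<and> R i j \<and> x \<in> carrier (ob D i)}"

definition colim ::
  "('k, 'm) ring_scheme \<Rightarrow> 'i set \<Rightarrow> ('i \<Rightarrow> 'i \<Rightarrow> bool) \<Rightarrow> ('i, 'k, 'v) diagram \<Rightarrow>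
   ('k, ('i \<Rightarrow> 'v) set) module" where
  "colim K I R D = quotient_space (family_sum I (ob D)) (colim_relations K I R D)"

definition colim_inj ::
  "('k, 'm) ring_scheme \<Rightarrow> 'i set \<Rightarrow> ('i \<Rightarrow> 'i \<Rightarrow> bool) \<Rightarrow> ('i, 'k, 'v) diagram \<Rightarrow>
   'i \<Rightarrow> 'v \<Rightarrow> ('i \<Rightarrow> 'v) set" where
  "colim_inj K I R D i x =
    colim_relations K I R D +>\<^bsub>family_sum I (ob D)\<^esub> family_inj I (ob D) i x"

text \<open>
  The map out of the colimit of \<open>D\<close> induced by a cocone \<open>\<phi>\<close> with vertex \<open>W\<close>: the map
  \<open>f \<mapsto> \<Sum>\<^sub>i \<phi>\<^sub>i (f\<^sub>i)\<close> on the direct sum is constant on every coset \<open>C\<close>.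
\<close>

definition colim_desc ::
  "'i set \<Rightarrow> ('i, 'k, 'v) diagram \<Rightarrow> ('k, 'w) module \<Rightarrow> ('i \<Rightarrow> 'v \<Rightarrow> 'w) \<Rightarrow> ('i \<Rightarrow> 'v) set \<Rightarrow> 'w" where
  "colim_desc I D W \<phi> C =
    the_elem ((\<lambda>f. \<Oplus>\<^bsub>W\<^esub> i \<in> {i \<in> I. f i \<noteq> \<zero>\<^bsub>ob D i\<^esub>}. \<phi> i (f i)) ` C)"

definition limit ::
  "'i set \<Rightarrow> ('i \<Rightarrow> 'i \<Rightarrow> bool) \<Rightarrow> ('i, 'k, 'v) diagram \<Rightarrow> ('k, 'i \<Rightarrow> 'v) module" where
  "limit I R D = (family_prod I (ob D))
    \<lparr>carrier := {f \<in> carrier (family_prod I (ob D)).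
       \<forall>i\<in>I. \<forall>j\<in>I. R i j \<longrightarrow> arr D i j (f i) = f j}\<rparr>"


section \<open>Kan extensions along an inclusion of preorders\<close>

text \<open>
  \<open>G\<close> is a functor on the full sub-preorder \<open>I\<close> of a preorder \<open>R\<close>. On arrows, the left Kan extension
  is induced by the inclusions of index sets \<open>{p. R p q} \<subseteq> {p. R p r}\<close>, and the right one restricts
  compatible families along \<open>{p. R r p} \<subseteq> {p. R q p}\<close>, whenever \<open>R q r\<close>.
\<close>

definition lan ::
  "('k, 'm) ring_scheme \<Rightarrow> 'i set \<Rightarrow> ('i \<Rightarrow> 'i \<Rightarrow> bool) \<Rightarrow> ('i, 'k, 'v) diagram \<Rightarrow>
   ('i, 'k, ('i \<Rightarrow> 'v) set) diagram" where
  "lan K I R G =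
    \<lparr>ob = (\<lambda>q. colim K {p \<in> I. R p q} R G),
     arr = (\<lambda>q r. colim_desc {p \<in> I. R p q} G (colim K {p \<in> I. R p r} R G)
       (colim_inj K {p \<in> I. R p r} R G))\<rparr>"

definition ran ::
  "'i set \<Rightarrow> ('i \<Rightarrow> 'i \<Rightarrow> bool) \<Rightarrow> ('i, 'k, 'v) diagram \<Rightarrow> ('i, 'k, 'i \<Rightarrow> 'v) diagram" where
  "ran I R G =
    \<lparr>ob = (\<lambda>q. limit {p \<in> I. R q p} R G),
     arr = (\<lambda>q r f. restrict f {p \<in> I. R r p})\<rparr>"

definition lan_to_ran ::
  "'i set \<Rightarrow> ('i \<Rightarrow> 'i \<Rightarrow> bool) \<Rightarrow> ('i, 'k, 'v) diagram \<Rightarrow> 'i \<Rightarrow> ('i \<Rightarrow> 'v) set \<Rightarrow> 'i \<Rightarrow> 'v" where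
  "lan_to_ran I R G q =
    colim_desc {p \<in> I. R p q} G (ob (ran I R G) q) (\<lambda>p x. \<lambda>p' \<in> {p' \<in> I. R q p'}. arr G p p' x)"

definition cen ::
  "('k, 'm) ring_scheme \<Rightarrow> 'i set \<Rightarrow> ('i \<Rightarrow> 'i \<Rightarrow> bool) \<Rightarrow> ('i, 'k, 'v) diagram \<Rightarrow>
   ('i, 'k, 'i \<Rightarrow> 'v) diagram" where
  "cen K I R G =
    \<lparr>ob = (\<lambda>q. (ob (ran I R G) q)\<lparr>carrier := lan_to_ran I R G q ` carrier (ob (lan K I R G) q)\<rparr>),
     arr = arr (ran I R G)\<rparr>"


section \<open>Interleavings of persistence modules\<close>

definition shift :: "real set \<Rightarrow> real \<Rightarrow> real \<Rightarrow> real" where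
  "shift X \<epsilon> x = min (x + \<epsilon>) (Sup X)"

text \<open>
  \<open>V\<close> shifted twice by \<open>\<epsilon>\<close> is \<open>V\<close> shifted by \<open>2\<epsilon>\<close>, since \<open>T\<^sub>\<epsilon> \<circ> T\<^sub>\<epsilon> = T\<^sub>2\<^sub>\<epsilon>\<close> on \<open>X\<close>; the transformation
  \<open>V\<sigma>\<^sub>2\<^sub>\<epsilon>\<close> has components \<open>arr V x (T\<^sub>2\<^sub>\<epsilon> x)\<close>.
\<close>

definition interleaving ::
  "('k, 'm) ring_scheme \<Rightarrow> real set \<Rightarrow> real \<Rightarrow> (real, 'k, 'u) diagram \<Rightarrow> (real, 'k, 'v) diagram \<Rightarrow>
   (real \<Rightarrow> 'u \<Rightarrow> 'v) \<Rightarrow> (real \<Rightarrow> 'v \<Rightarrow> 'u) \<Rightarrow> bool" where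
  "interleaving K X \<epsilon> U V \<Phi> \<Psi> \<longleftrightarrow>
    0 \<le> \<epsilon> \<and> vect_functor K X (\<le>) U \<and> vect_functor K X (\<le>) V \<and>
    nat_trans K X (\<le>) U (precompose V (shift X \<epsilon>)) \<Phi> \<and>
    nat_trans K X (\<le>) V (precompose U (shift X \<epsilon>)) \<Psi> \<and>
    (\<forall>x\<in>X. \<forall>u \<in> carrier (ob U x). \<Psi> (shift X \<epsilon> x) (\<Phi> x u) = arr U x (shift X (2 * \<epsilon>) x) u) \<and>
    (\<forall>x\<in>X. \<forall>v \<in> carrier (ob V x). \<Phi> (shift X \<epsilon> x) (\<Psi> x v) = arr V x (shift X (2 * \<epsilon>) x) v)"


section \<open>The persistent homology transform and its Kan extensions\<close>

text \<open>
  The height \<open>h\<close> turns a parameter into a sublevel: the identity for \<open>[-1, 1]\<close>, the cosine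
  for \<open>[-\<pi>, 0]\<close>.
\<close>

definition pht ::
  "('k, 'm) ring_scheme \<Rightarrow> nat \<Rightarrow> (real \<Rightarrow> real) \<Rightarrow> nat \<Rightarrow> (nat \<Rightarrow> real) set \<Rightarrow> (nat \<Rightarrow> real) \<Rightarrow>
   (real, 'k, ((nat \<Rightarrow> real) sing \<Rightarrow> 'k) set) diagram" where
  "pht K d h n M v =
    \<lparr>ob = (\<lambda>t. homology K n (sublevel d M v (h t))),
     arr = (\<lambda>s t. homology_map K n (sublevel d M v (h s)) (sublevel d M v (h t)) id)\<rparr>"

definition spacetime_le ::
  "real set \<Rightarrow> ('v \<Rightarrow> 'v \<Rightarrow> real) \<Rightarrow> 'v \<times> real \<Rightarrow> 'v \<times> real \<Rightarrow> bool" where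
  "spacetime_le X \<delta> = (\<lambda>(v, \<alpha>) (w, \<beta>). \<alpha> + \<delta> v w \<le> \<beta> \<or> \<beta> = Sup X)"

definition spacetime_pht ::
  "('k, 'm) ring_scheme \<Rightarrow> nat \<Rightarrow> (real \<Rightarrow> real) \<Rightarrow> nat \<Rightarrow> (nat \<Rightarrow> real) set \<Rightarrow>
   ((nat \<Rightarrow> real) \<times> real, 'k, ((nat \<Rightarrow> real) sing \<Rightarrow> 'k) set) diagram" where
  "spacetime_pht K d h n M =
    \<lparr>ob = (\<lambda>(v, \<alpha>). ob (pht K d h n M v) \<alpha>),
     arr = (\<lambda>(v, \<alpha>) (w, \<beta>). homology_map K n (sublevel d M v (h \<alpha>)) (sublevel d M w (h \<beta>)) id)\<rparr>"

definition pht_left where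
  "pht_left K d X \<delta> h A n M w =
    precompose (lan K (A \<times> X) (spacetime_le X \<delta>) (spacetime_pht K d h n M)) (Pair w)"

definition pht_right where
  "pht_right K d X \<delta> h A n M w =
    precompose (ran (A \<times> X) (spacetime_le X \<delta>) (spacetime_pht K d h n M)) (Pair w)"

definition pht_center where
  "pht_center K d X \<delta> h A n M w =
    precompose (cen K (A \<times> X) (spacetime_le X \<delta>) (spacetime_pht K d h n M)) (Pair w)"

end

theory Submission
  imports Defs
begin

text \<open>
  Write \<open>\<delta>\<close> for the distance from the sampled direction \<open>v\<close> to \<open>w\<close>. In space-time there are morphisms
  \<open>(w, t) \<rightarrow> (v, t + \<delta>) \<rightarrow> (w, t + 2\<delta>)\<close>, so moving along the line of \<open>w\<close> by \<open>2\<delta>\<close> factors through a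
  sampled point (all times are truncated at \<open>Sup X\<close>). Each Kan extension is built from the values of \<open>G\<close>
  at sampled points, and this is what lets \<open>G\<close> and its extension be exchanged on the line of \<open>w\<close> at
  the cost of a shift by \<open>2\<delta>\<close>.

  In detail, let \<open>T\<close> be the shift by \<open>2\<delta>\<close>. The left extension comes with the counit \<open>Lan \<rightarrow> G\<close>, and the
  opposite map \<open>G(w, t) \<rightarrow> G(v, t + \<delta>) \<rightarrow> Lan(w, T t)\<close> uses the coprojection of the sampled point. The
  right extension comes with the unit \<open>G \<rightarrow> Ran\<close>, and the opposite map
  \<open>Ran(w, t) \<rightarrow> G(v, t + \<delta>) \<rightarrow> G(w, T t)\<close> evaluates a compatible family at the sampled point. Each
  composite can be checked on coprojections or on components, where it is functoriality of \<open>G\<close>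
  (\<open>lan_interleaving\<close>, \<open>ran_interleaving\<close>). The center extension is the image of \<open>Lan \<rightarrow> G \<rightarrow> Ran\<close>. The
  maps for \<open>Ran\<close> restrict to it, because the shifted unit factors through the sampled point and hence
  through \<open>Lan\<close> (\<open>cen_interleaving\<close>). This part holds for every functor on a preorder and every
  monotone curve in it that has such sampled midpoints.

  Three inputs remain. Colimits and limits of vector spaces are computed on direct sums and products,
  where their universal properties have to be verified. Homology over \<open>K\<close> has to be a functor, for
  which \<open>\<partial>\<partial> = 0\<close> is transported from integral chains. Finally, space-time has to be a preorder on which
  sublevel sets increase. For the Euclidean distance this is the Cauchy-Schwarz inequality. For the
  geodesic distance both the triangle inequality and the monotonicity follow from a single bound on
  the height in direction \<open>w\<close> of points of the ball whose height in direction \<open>v\<close> is at most \<open>cos a\<close>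
  (\<open>height_in_cap_le\<close>).
\<close>

section \<open>Linear maps and subspaces\<close>

lemma linear_mapI:
  assumes "vectorspace K V" "vectorspace K W"
    and "\<And>x. x \<in> carrier V \<Longrightarrow> T x \<in> carrier W"
    and "\<And>x y. \<lbrakk>x \<in> carrier V; y \<in> carrier V\<rbrakk> \<Longrightarrow> T (x \<oplus>\<^bsub>V\<^esub> y) = T x \<oplus>\<^bsub>W\<^esub> T y"
    and "\<And>c x. \<lbrakk>c \<in> carrier K; x \<in> carrier V\<rbrakk> \<Longrightarrow> T (c \<odot>\<^bsub>V\<^esub> x) = c \<odot>\<^bsub>W\<^esub> T x"
  shows "linear_map K V W T"
  using assms
  by (auto simp: linear_map_def mod_hom_def mod_hom_axioms_def module_hom_def vectorspace_def)

lemma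
  assumes "linear_map K V W T"
  shows linear_map_dom: "vectorspace K V"
    and linear_map_cod: "vectorspace K W"
    and linear_map_closed: "x \<in> carrier V \<Longrightarrow> T x \<in> carrier W"
    and linear_map_add: "\<lbrakk>x \<in> carrier V; y \<in> carrier V\<rbrakk> \<Longrightarrow> T (x \<oplus>\<^bsub>V\<^esub> y) = T x \<oplus>\<^bsub>W\<^esub> T y"
    and linear_map_smult: "\<lbrakk>c \<in> carrier K; x \<in> carrier V\<rbrakk> \<Longrightarrow> T (c \<odot>\<^bsub>V\<^esub> x) = c \<odot>\<^bsub>W\<^esub> T x"
    and linear_map_zero: "T \<zero>\<^bsub>V\<^esub> = \<zero>\<^bsub>W\<^esub>"
    and linear_map_minus:
      "\<lbrakk>x \<in> carrier V; y \<in> carrier V\<rbrakk> \<Longrightarrow> T (x \<ominus>\<^bsub>V\<^esub> y) = T x \<ominus>\<^bsub>W\<^esub> T y"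
proof -
  interpret T: linear_map K V W T by fact
  show "vectorspace K V" "vectorspace K W" by intro_locales
  show "x \<in> carrier V \<Longrightarrow> T x \<in> carrier W"
    and "\<lbrakk>x \<in> carrier V; y \<in> carrier V\<rbrakk> \<Longrightarrow> T (x \<oplus>\<^bsub>V\<^esub> y) = T x \<oplus>\<^bsub>W\<^esub> T y"
    and "\<lbrakk>c \<in> carrier K; x \<in> carrier V\<rbrakk> \<Longrightarrow> T (c \<odot>\<^bsub>V\<^esub> x) = c \<odot>\<^bsub>W\<^esub> T x"
    and "T \<zero>\<^bsub>V\<^esub> = \<zero>\<^bsub>W\<^esub>"
    and "\<lbrakk>x \<in> carrier V; y \<in> carrier V\<rbrakk> \<Longrightarrow> T (x \<ominus>\<^bsub>V\<^esub> y) = T x \<ominus>\<^bsub>W\<^esub> T y"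
    by simp_all
qed

lemma linear_map_comp:
  assumes S: "linear_map K V W S" and T: "linear_map K W U T"
  shows "linear_map K V U (\<lambda>x. T (S x))"
  by (rule linear_mapI)
    (simp_all add: linear_map_dom[OF S] linear_map_cod[OF T] linear_map_closed[OF S]
      linear_map_closed[OF T] linear_map_add[OF S] linear_map_add[OF T]
      linear_map_smult[OF S] linear_map_smult[OF T])

lemma linear_map_cong:
  assumes T: "linear_map K V W T" and eq: "\<And>x. x \<in> carrier V \<Longrightarrow> S x = T x"
  shows "linear_map K V W S"
proof -
  interpret V: vectorspace K V by (rule linear_map_dom[OF T])
  show ?thesis
    by (rule linear_mapI)
      (simp_all add: linear_map_dom[OF T] linear_map_cod[OF T] eq linear_map_closed[OF T]
        linear_map_add[OF T] linear_map_smult[OF T])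
qed

lemma linear_map_finsum:
  assumes T: "linear_map K V W T" and g: "g \<in> A \<rightarrow> carrier V"
  shows "T (\<Oplus>\<^bsub>V\<^esub> a \<in> A. g a) = (\<Oplus>\<^bsub>W\<^esub> a \<in> A. T (g a))"
proof -
  interpret V: vectorspace K V by (rule linear_map_dom[OF T])
  interpret W: vectorspace K W by (rule linear_map_cod[OF T])
  show ?thesis using g
  proof (induct A rule: infinite_finite_induct)
    case (insert a A)
    then have "(\<Oplus>\<^bsub>W\<^esub> a \<in> insert a A. T (g a)) = T (g a) \<oplus>\<^bsub>W\<^esub> (\<Oplus>\<^bsub>W\<^esub> a \<in> A. T (g a))"
      by (intro W.M.finsum_insert) (auto intro: linear_map_closed[OF T])
    with insert show ?case by (simp add: linear_map_add[OF T])
  qed (simp_all add: linear_map_zero[OF T])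
qed

lemma linear_map_zero_map:
  assumes "vectorspace K V" "vectorspace K W"
  shows "linear_map K V W (\<lambda>x. \<zero>\<^bsub>W\<^esub>)"
proof -
  interpret W: vectorspace K W by fact
  show ?thesis by (rule linear_mapI) (simp_all add: assms)
qed

lemma subspaceI:
  assumes "vectorspace K V" "W \<subseteq> carrier V" "\<zero>\<^bsub>V\<^esub> \<in> W"
    and "\<And>x y. \<lbrakk>x \<in> W; y \<in> W\<rbrakk> \<Longrightarrow> x \<oplus>\<^bsub>V\<^esub> y \<in> W"
    and "\<And>c x. \<lbrakk>c \<in> carrier K; x \<in> W\<rbrakk> \<Longrightarrow> c \<odot>\<^bsub>V\<^esub> x \<in> W"
  shows "subspace K W V"
  using assms
  by (auto simp: subspace_def LinearCombinations.submodule_def vectorspace_def)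

lemma
  assumes "subspace K W V"
  shows subspace_vectorspace: "vectorspace K V"
    and subspace_subset: "W \<subseteq> carrier V"
    and subspace_zero: "\<zero>\<^bsub>V\<^esub> \<in> W"
    and subspace_add: "\<lbrakk>x \<in> W; y \<in> W\<rbrakk> \<Longrightarrow> x \<oplus>\<^bsub>V\<^esub> y \<in> W"
    and subspace_smult: "\<lbrakk>c \<in> carrier K; x \<in> W\<rbrakk> \<Longrightarrow> c \<odot>\<^bsub>V\<^esub> x \<in> W"
    and vectorspace_subspace: "vectorspace K (V\<lparr>carrier := W\<rparr>)"
  using assms vectorspace.subspace_is_vs[of K V W]
  by (auto simp: subspace_def LinearCombinations.submodule_def)

lemma linear_map_into_subspace:
  assumes T: "linear_map K V W T" and U: "subspace K U W" and "\<And>x. x \<in> carrier V \<Longrightarrow> T x \<in> U"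
  shows "linear_map K V (W\<lparr>carrier := U\<rparr>) T"
  by (rule linear_mapI)
    (simp_all add: assms linear_map_dom[OF T] vectorspace_subspace[OF U] linear_map_add[OF T]
      linear_map_smult[OF T])

lemma linear_map_on_subspace:
  assumes T: "linear_map K V W T" and U: "subspace K U V"
  shows "linear_map K (V\<lparr>carrier := U\<rparr>) W T"
  using subspace_subset[OF U]
  by (intro linear_mapI)
    (auto simp: linear_map_cod[OF T] vectorspace_subspace[OF U] linear_map_add[OF T]
      linear_map_smult[OF T] linear_map_closed[OF T] subset_iff)

lemma subspace_image:
  assumes "linear_map K V W T"
  shows "subspace K (T ` carrier V) W"
  using linear_map.imT_is_subspace[OF assms] mod_hom.im_def[of K V W T] assms
  by (simp add: linear_map_def)

lemma subspace_kernel: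
  assumes "linear_map K V W T"
  shows "subspace K {x \<in> carrier V. T x = \<zero>\<^bsub>W\<^esub>} V"
  using linear_map.kerT_is_subspace[OF assms] mod_hom.ker_def[of K V W T] assms
  by (simp add: linear_map_def)

text \<open>Carries the vector space structure from a direct sum of lines over to a free space.\<close>

lemma vectorspace_cong:
  assumes "vectorspace K V" "carrier U = carrier V" "zero U = zero V" "add U = add V"
    "smult U = smult V"
  shows "vectorspace K U"
proof -
  interpret V: vectorspace K V by fact
  have "\<exists>y\<in>carrier V. x \<oplus>\<^bsub>V\<^esub> y = \<zero>\<^bsub>V\<^esub>" if "x \<in> carrier V" for x
    using that by (intro bexI[of _ "\<ominus>\<^bsub>V\<^esub> x"]) (auto simp: V.M.r_neg)
  then show ?thesis
    by (intro vs_criteria)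
      (auto simp: assms(2-) V.M.a_ac V.smult_assoc1 V.smult_l_distr V.smult_r_distr V.field_axioms)
qed


section \<open>Quotient spaces\<close>

lemma abelian_subgroup_subspace:
  assumes W: "subspace K W V"
  shows "abelian_subgroup W V"
proof -
  interpret V: vectorspace K V by (rule subspace_vectorspace[OF W])
  have "\<ominus>\<^bsub>V\<^esub> x \<in> W" if "x \<in> W" for x
    using that subspace_smult[OF W, of "\<ominus>\<^bsub>K\<^esub> \<one>\<^bsub>K\<^esub>" x] subspace_subset[OF W]
    by (auto simp: V.smult_minus_1)
  then show ?thesis
    by (intro abelian_subgroupI3 additive_subgroup.intro V.M.add.subgroupI)
      (use subspace_subset[OF W] subspace_zero[OF W] subspace_add[OF W] V.M.abelian_group_axioms
       in \<open>auto simp flip: a_inv_def\<close>)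
qed

lemma coset_cases:
  assumes "C \<in> carrier (quotient_space V W)"
  obtains x where "x \<in> carrier V" "C = W +>\<^bsub>V\<^esub> x"
  using assms by (auto simp: quotient_space_def A_RCOSETS_def' a_r_coset_def')

lemma coset_in_quotient: "x \<in> carrier V \<Longrightarrow> W +>\<^bsub>V\<^esub> x \<in> carrier (quotient_space V W)"
  by (auto simp: quotient_space_def A_RCOSETS_def' a_r_coset_def')

text \<open>
  The maps out of quotients, namely on homology and on colimits, are defined through the image of a
  whole coset. This evaluates them on a representative.
\<close>

lemma linear_image_coset:
  assumes W: "subspace K W V" and T: "linear_map K V U T"
    and W0: "\<And>y. y \<in> W \<Longrightarrow> T y = \<zero>\<^bsub>U\<^esub>" and x: "x \<in> carrier V"
  shows "T ` (W +>\<^bsub>V\<^esub> x) = {T x}"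
proof -
  interpret U: vectorspace K U by (rule linear_map_cod[OF T])
  have "T (y \<oplus>\<^bsub>V\<^esub> x) = T x" if "y \<in> W" for y
    using that x subspace_subset[OF W]
    by (auto simp: linear_map_add[OF T] W0 linear_map_closed[OF T])
  moreover from this have "T x \<in> T ` (W +>\<^bsub>V\<^esub> x)"
    using subspace_zero[OF W] by (intro rev_image_eqI[of "\<zero>\<^bsub>V\<^esub> \<oplus>\<^bsub>V\<^esub> x"]) (auto simp: a_r_coset_def')
  ultimately show ?thesis by (auto simp: a_r_coset_def')
qed

lemma coset_eq:
  assumes W: "subspace K W V" and x: "x \<in> carrier V" and y: "y \<in> carrier V"
    and d: "x \<ominus>\<^bsub>V\<^esub> y \<in> W"
  shows "W +>\<^bsub>V\<^esub> x = W +>\<^bsub>V\<^esub> y"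
proof -
  interpret W: abelian_subgroup W V by (rule abelian_subgroup_subspace[OF W])
  have "x \<in> W +>\<^bsub>V\<^esub> y" using d x y by (simp add: W.a_rcos_module a_minus_def)
  then show ?thesis using W.a_repr_independence' y by simp
qed

lemma coset_add:
  assumes W: "subspace K W V" and "x \<in> carrier V" "y \<in> carrier V"
  shows "(W +>\<^bsub>V\<^esub> x) \<oplus>\<^bsub>quotient_space V W\<^esub> (W +>\<^bsub>V\<^esub> y) = W +>\<^bsub>V\<^esub> (x \<oplus>\<^bsub>V\<^esub> y)"
  using abelian_subgroup.a_rcos_sum[OF abelian_subgroup_subspace[OF W] assms(2,3)]
  by (simp add: quotient_space_def)

lemma coset_smult:
  assumes W: "subspace K W V" and c: "c \<in> carrier K" and x: "x \<in> carrier V"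
  shows "c \<odot>\<^bsub>quotient_space V W\<^esub> (W +>\<^bsub>V\<^esub> x) = W +>\<^bsub>V\<^esub> (c \<odot>\<^bsub>V\<^esub> x)"
proof -
  interpret V: vectorspace K V by (rule subspace_vectorspace[OF W])
  have "W +>\<^bsub>V\<^esub> (c \<odot>\<^bsub>V\<^esub> (y \<oplus>\<^bsub>V\<^esub> x)) = W +>\<^bsub>V\<^esub> (c \<odot>\<^bsub>V\<^esub> x)" if y: "y \<in> W" for y
  proof (rule coset_eq[OF W])
    have yV: "y \<in> carrier V" using y subspace_subset[OF W] by auto
    have "c \<odot>\<^bsub>V\<^esub> (y \<oplus>\<^bsub>V\<^esub> x) \<ominus>\<^bsub>V\<^esub> c \<odot>\<^bsub>V\<^esub> x = c \<odot>\<^bsub>V\<^esub> y"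
      using yV c x by (simp add: V.smult_r_distr a_minus_def V.M.a_assoc V.M.r_neg)
    then show "c \<odot>\<^bsub>V\<^esub> (y \<oplus>\<^bsub>V\<^esub> x) \<ominus>\<^bsub>V\<^esub> c \<odot>\<^bsub>V\<^esub> x \<in> W"
      using subspace_smult[OF W c y] by simp
    show "c \<odot>\<^bsub>V\<^esub> (y \<oplus>\<^bsub>V\<^esub> x) \<in> carrier V" "c \<odot>\<^bsub>V\<^esub> x \<in> carrier V"
      using yV c x by simp_all
  qed
  then show ?thesis using subspace_zero[OF W]
    by (auto simp: quotient_space_def a_r_coset_def')
qed

lemma quotient_zero:
  assumes W: "subspace K W V"
  shows "\<zero>\<^bsub>quotient_space V W\<^esub> = W +>\<^bsub>V\<^esub> \<zero>\<^bsub>V\<^esub>"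
  using abelian_subgroup.a_rcos_const[OF abelian_subgroup_subspace[OF W] subspace_zero[OF W]]
  by (simp add: quotient_space_def)

lemma vectorspace_quotient:
  assumes W: "subspace K W V"
  shows "vectorspace K (quotient_space V W)"
proof -
  interpret V: vectorspace K V by (rule subspace_vectorspace[OF W])
  have neg: "\<exists>D\<in>carrier (quotient_space V W). C \<oplus>\<^bsub>quotient_space V W\<^esub> D = \<zero>\<^bsub>quotient_space V W\<^esub>"
    if "C \<in> carrier (quotient_space V W)" for C
    using that
  proof (rule coset_cases)
    fix x assume x: "x \<in> carrier V" and C: "C = W +>\<^bsub>V\<^esub> x"
    show ?thesis
      by (rule bexI[of _ "W +>\<^bsub>V\<^esub> (\<ominus>\<^bsub>V\<^esub> x)"])
        (use x in \<open>simp_all add: C coset_add[OF W] quotient_zero[OF W] V.M.r_neg coset_in_quotient\<close>)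
  qed
  show ?thesis
  proof (rule vs_criteria)
    show "\<forall>C\<in>carrier (quotient_space V W). \<exists>D\<in>carrier (quotient_space V W).
        C \<oplus>\<^bsub>quotient_space V W\<^esub> D = \<zero>\<^bsub>quotient_space V W\<^esub>"
      using neg by blast
  qed (auto elim!: coset_cases
        simp: V.field_axioms quotient_zero[OF W] coset_add[OF W] coset_smult[OF W] coset_in_quotient
          V.M.a_ac V.smult_assoc1 V.smult_l_distr V.smult_r_distr)
qed

lemma linear_map_coset:
  assumes W: "subspace K W V"
  shows "linear_map K V (quotient_space V W) (\<lambda>x. W +>\<^bsub>V\<^esub> x)"
  by (rule linear_mapI)
    (simp_all add: subspace_vectorspace[OF W] vectorspace_quotient[OF W] coset_in_quotient
      coset_add[OF W] coset_smult[OF W])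

lemma linear_map_from_quotient:
  assumes W: "subspace K W V" and T: "linear_map K V U T"
    and S: "\<And>x. x \<in> carrier V \<Longrightarrow> S (W +>\<^bsub>V\<^esub> x) = T x"
  shows "linear_map K (quotient_space V W) U S"
proof -
  interpret V: vectorspace K V by (rule subspace_vectorspace[OF W])
  show ?thesis
    by (rule linear_mapI)
      (auto elim!: coset_cases simp: vectorspace_quotient[OF W] linear_map_cod[OF T] S
        coset_add[OF W] coset_smult[OF W] linear_map_closed[OF T] linear_map_add[OF T]
        linear_map_smult[OF T])
qed


section \<open>Products and direct sums of families\<close>

lemma vectorspace_family_prod:
  assumes K: "field K" and V: "\<And>i. i \<in> I \<Longrightarrow> vectorspace K (V i)"
  shows "vectorspace K (family_prod I V)"
proof -
  have mod: "module K (V i)" and ab: "abelian_group (V i)" if "i \<in> I" for i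
    using V[OF that] by (auto simp: vectorspace_def module_def)
  note am = ab[THEN abelian_group.axioms(1)]
  have neg: "\<exists>g\<in>carrier (family_prod I V). f \<oplus>\<^bsub>family_prod I V\<^esub> g = \<zero>\<^bsub>family_prod I V\<^esub>"
    if "f \<in> carrier (family_prod I V)" for f
    using that
    by (intro bexI[of _ "\<lambda>i\<in>I. \<ominus>\<^bsub>V i\<^esub> f i"])
      (auto simp: family_prod_def PiE_iff abelian_group.r_neg[OF ab]
        abelian_group.a_inv_closed[OF ab] intro!: restrict_ext)
  have ext: "(\<lambda>i\<in>I. g i) = f" if "f \<in> carrier (family_prod I V)" "\<And>i. i \<in> I \<Longrightarrow> g i = f i" for f g
    using that by (auto simp: family_prod_def PiE_iff extensional_def)
  show ?thesis
  proof (rule vs_criteria[OF K])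
    show "\<forall>f\<in>carrier (family_prod I V). \<exists>g\<in>carrier (family_prod I V).
        f \<oplus>\<^bsub>family_prod I V\<^esub> g = \<zero>\<^bsub>family_prod I V\<^esub>"
      using neg by blast
    show "\<forall>f g. f \<in> carrier (family_prod I V) \<and> g \<in> carrier (family_prod I V) \<longrightarrow>
        f \<oplus>\<^bsub>family_prod I V\<^esub> g = g \<oplus>\<^bsub>family_prod I V\<^esub> f"
      by (auto simp: family_prod_def PiE_iff intro!: restrict_ext abelian_monoid.a_comm[OF am])
  qed (auto simp: family_prod_def PiE_iff abelian_monoid.a_closed[OF am]
      abelian_monoid.zero_closed[OF am] module.smult_closed[OF mod]
      module.smult_assoc1[OF mod] module.smult_l_distr[OF mod] module.smult_r_distr[OF mod]
      abelian_monoid.a_assoc[OF am] module.smult_one[OF mod]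
      abelian_monoid.r_zero[OF am] extensional_def intro!: restrict_ext ext)
qed

lemma linear_map_into_family_prod:
  assumes K: "field K" and U: "vectorspace K U"
    and T: "\<And>i. i \<in> I \<Longrightarrow> linear_map K U (V i) (T i)"
  shows "linear_map K U (family_prod I V) (\<lambda>x. \<lambda>i\<in>I. T i x)"
proof -
  have "vectorspace K (V i)" if "i \<in> I" for i using linear_map_cod[OF T[OF that]] .
  then show ?thesis
    by (intro linear_mapI U vectorspace_family_prod K)
      (auto simp: family_prod_def linear_map_closed[OF T] linear_map_add[OF T]
        linear_map_smult[OF T])
qed

lemma linear_map_eval:
  assumes K: "field K" and V: "\<And>i. i \<in> I \<Longrightarrow> vectorspace K (V i)" and i: "i \<in> I"
  shows "linear_map K (family_prod I V) (V i) (\<lambda>f. f i)"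
  by (rule linear_mapI)
    (use i in \<open>auto simp: vectorspace_family_prod[OF K V] V, auto simp: family_prod_def\<close>)

lemma subspace_family_sum:
  assumes K: "field K" and V: "\<And>i. i \<in> I \<Longrightarrow> vectorspace K (V i)"
  shows "subspace K (carrier (family_sum I V)) (family_prod I V)"
proof -
  have mod: "module K (V i)" and ab: "abelian_group (V i)" if "i \<in> I" for i
    using V[OF that] by (auto simp: vectorspace_def module_def)
  note am = ab[THEN abelian_group.axioms(1)]
  interpret P: vectorspace K "family_prod I V" by (rule vectorspace_family_prod[OF K V])
  show ?thesis
  proof (rule subspaceI)
    fix f g assume f: "f \<in> carrier (family_sum I V)" and g: "g \<in> carrier (family_sum I V)"
    have "{i \<in> I. (f \<oplus>\<^bsub>family_prod I V\<^esub> g) i \<noteq> \<zero>\<^bsub>V i\<^esub>} \<subseteq>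
        {i \<in> I. f i \<noteq> \<zero>\<^bsub>V i\<^esub>} \<union> {i \<in> I. g i \<noteq> \<zero>\<^bsub>V i\<^esub>}"
      by (auto simp: family_prod_def abelian_monoid.l_zero[OF am] abelian_monoid.zero_closed[OF am])
    then show "f \<oplus>\<^bsub>family_prod I V\<^esub> g \<in> carrier (family_sum I V)"
      using f g by (auto simp: family_sum_def intro: finite_subset)
  next
    fix c f assume c: "c \<in> carrier K" and f: "f \<in> carrier (family_sum I V)"
    have "{i \<in> I. (c \<odot>\<^bsub>family_prod I V\<^esub> f) i \<noteq> \<zero>\<^bsub>V i\<^esub>} \<subseteq> {i \<in> I. f i \<noteq> \<zero>\<^bsub>V i\<^esub>}"
      using c by (auto simp: family_prod_def module.rmult_0[OF mod])
    then show "c \<odot>\<^bsub>family_prod I V\<^esub> f \<in> carrier (family_sum I V)"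
      using c f by (auto simp: family_sum_def intro: finite_subset)
  qed (use P.vectorspace_axioms in \<open>auto simp: family_sum_def, auto simp: family_prod_def\<close>)
qed

lemma vectorspace_family_sum:
  assumes "field K" "\<And>i. i \<in> I \<Longrightarrow> vectorspace K (V i)"
  shows "vectorspace K (family_sum I V)"
  using vectorspace_subspace[OF subspace_family_sum[OF assms]] by (simp add: family_sum_def)

lemma linear_map_family_inj:
  assumes K: "field K" and V: "\<And>i. i \<in> I \<Longrightarrow> vectorspace K (V i)" and i: "i \<in> I"
  shows "linear_map K (V i) (family_sum I V) (family_inj I V i)"
proof -
  have "linear_map K (V i) (V j) (\<lambda>x. if j = i then x else \<zero>\<^bsub>V j\<^esub>)" if j: "j \<in> I" for j
    using linear_map_zero_map[OF V[OF i] V[OF j]] linear_mapI[OF V[OF i] V[OF i], of "\<lambda>x. x"]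
    by (cases "j = i") auto
  moreover have "family_inj I V i = (\<lambda>x. \<lambda>j\<in>I. if j = i then x else \<zero>\<^bsub>V j\<^esub>)"
    by (simp add: family_inj_def fun_eq_iff)
  ultimately have L: "linear_map K (V i) (family_prod I V) (family_inj I V i)"
    using linear_map_into_family_prod[where V = V and I = I, OF K V[OF i]] by simp
  have "finite {j \<in> I. family_inj I V i x j \<noteq> \<zero>\<^bsub>V j\<^esub>}" for x
    by (rule finite_subset[of _ "{i}"]) (auto simp: family_inj_def)
  then show ?thesis
    using linear_map_into_subspace[OF L subspace_family_sum[OF K V]]
    by (simp add: family_sum_def linear_map_closed[OF L])
qed

text \<open>
  The map out of a direct sum given by the universal property of the coproduct. The linear extension
  from a basis and the map induced by a cocone are both of this form.
\<close>

definition family_copair ::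
  "'i set \<Rightarrow> ('i \<Rightarrow> ('k, 'v) module) \<Rightarrow> ('k, 'w) module \<Rightarrow> ('i \<Rightarrow> 'v \<Rightarrow> 'w) \<Rightarrow> ('i \<Rightarrow> 'v) \<Rightarrow> 'w" where
  "family_copair I V W \<phi> f = (\<Oplus>\<^bsub>W\<^esub> i \<in> {i \<in> I. f i \<noteq> \<zero>\<^bsub>V i\<^esub>}. \<phi> i (f i))"

lemma linear_map_family_copair:
  assumes K: "field K" and W: "vectorspace K W"
    and \<phi>: "\<And>i. i \<in> I \<Longrightarrow> linear_map K (V i) W (\<phi> i)"
  shows "linear_map K (family_sum I V) W (family_copair I V W \<phi>)"
proof -
  interpret W: vectorspace K W by fact
  have V: "vectorspace K (V i)" if "i \<in> I" for i using linear_map_dom[OF \<phi>[OF that]] .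
  interpret S: vectorspace K "family_sum I V" by (rule vectorspace_family_sum[OF K V])
  have mem: "f i \<in> carrier (V i)" if "f \<in> carrier (family_sum I V)" "i \<in> I" for f i
    using that by (auto simp: family_sum_def family_prod_def)
  have cl: "\<phi> i (f i) \<in> carrier W" if "f \<in> carrier (family_sum I V)" "i \<in> I" for f i
    using linear_map_closed[OF \<phi>] mem that by blast
  \<comment> \<open>The sum may be taken over any finite set containing the support, so that the supports of
     two families can be replaced by their union.\<close>
  have enlarge: "family_copair I V W \<phi> f = (\<Oplus>\<^bsub>W\<^esub> i \<in> F. \<phi> i (f i))"
    if "f \<in> carrier (family_sum I V)" "finite F" "F \<subseteq> I" "{i \<in> I. f i \<noteq> \<zero>\<^bsub>V i\<^esub>} \<subseteq> F" for f F
    unfolding family_copair_def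
    by (rule W.M.add.finprod_mono_neutral_cong_left)
      (use that cl in \<open>auto simp: linear_map_zero[OF \<phi>] subset_iff\<close>)
  have fin: "finite {i \<in> I. f i \<noteq> \<zero>\<^bsub>V i\<^esub>}" if "f \<in> carrier (family_sum I V)" for f
    using that by (auto simp: family_sum_def)
  show ?thesis
  proof (rule linear_mapI[OF S.vectorspace_axioms W])
    fix f assume "f \<in> carrier (family_sum I V)"
    then show "family_copair I V W \<phi> f \<in> carrier W"
      unfolding family_copair_def by (intro W.M.finsum_closed) (auto intro: cl)
  next
    fix f g assume f: "f \<in> carrier (family_sum I V)" and g: "g \<in> carrier (family_sum I V)"
    define F where "F = {i \<in> I. f i \<noteq> \<zero>\<^bsub>V i\<^esub>} \<union> {i \<in> I. g i \<noteq> \<zero>\<^bsub>V i\<^esub>} \<union>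
      {i \<in> I. (f \<oplus>\<^bsub>family_sum I V\<^esub> g) i \<noteq> \<zero>\<^bsub>V i\<^esub>}"
    have fg: "f \<oplus>\<^bsub>family_sum I V\<^esub> g \<in> carrier (family_sum I V)" using f g by simp
    have F: "finite F" "F \<subseteq> I" unfolding F_def using fin f g fg by auto
    have eq: "\<phi> i ((f \<oplus>\<^bsub>family_sum I V\<^esub> g) i) = \<phi> i (f i) \<oplus>\<^bsub>W\<^esub> \<phi> i (g i)" if "i \<in> F" for i
      using that F f g
      by (auto simp: family_sum_def family_prod_def PiE_iff subset_iff linear_map_add[OF \<phi>])
    have "family_copair I V W \<phi> (f \<oplus>\<^bsub>family_sum I V\<^esub> g) =
        (\<Oplus>\<^bsub>W\<^esub> i \<in> F. \<phi> i ((f \<oplus>\<^bsub>family_sum I V\<^esub> g) i))"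
      by (rule enlarge[OF fg F]) (auto simp: F_def)
    also have "\<dots> = (\<Oplus>\<^bsub>W\<^esub> i \<in> F. \<phi> i (f i) \<oplus>\<^bsub>W\<^esub> \<phi> i (g i))"
      using F by (intro W.M.finsum_cong') (auto simp: eq intro!: cl f g)
    also have "\<dots> = (\<Oplus>\<^bsub>W\<^esub> i \<in> F. \<phi> i (f i)) \<oplus>\<^bsub>W\<^esub> (\<Oplus>\<^bsub>W\<^esub> i \<in> F. \<phi> i (g i))"
      using F by (intro W.M.finsum_addf) (auto intro!: cl f g)
    also have "\<dots> = family_copair I V W \<phi> f \<oplus>\<^bsub>W\<^esub> family_copair I V W \<phi> g"
      by (subst (1 2) enlarge[OF _ F]) (auto simp: F_def f g)
    finally show "family_copair I V W \<phi> (f \<oplus>\<^bsub>family_sum I V\<^esub> g) =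
        family_copair I V W \<phi> f \<oplus>\<^bsub>W\<^esub> family_copair I V W \<phi> g" .
  next
    fix c f assume c: "c \<in> carrier K" and f: "f \<in> carrier (family_sum I V)"
    define F where "F = {i \<in> I. f i \<noteq> \<zero>\<^bsub>V i\<^esub>} \<union>
      {i \<in> I. (c \<odot>\<^bsub>family_sum I V\<^esub> f) i \<noteq> \<zero>\<^bsub>V i\<^esub>}"
    have cf: "c \<odot>\<^bsub>family_sum I V\<^esub> f \<in> carrier (family_sum I V)" using c f by simp
    have F: "finite F" "F \<subseteq> I" unfolding F_def using fin f cf by auto
    have eq: "\<phi> i ((c \<odot>\<^bsub>family_sum I V\<^esub> f) i) = c \<odot>\<^bsub>W\<^esub> \<phi> i (f i)" if "i \<in> F" for i
      using that F f c
      by (auto simp: family_sum_def family_prod_def PiE_iff subset_iff linear_map_smult[OF \<phi>])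
    have "family_copair I V W \<phi> (c \<odot>\<^bsub>family_sum I V\<^esub> f) =
        (\<Oplus>\<^bsub>W\<^esub> i \<in> F. \<phi> i ((c \<odot>\<^bsub>family_sum I V\<^esub> f) i))"
      by (rule enlarge[OF cf F]) (auto simp: F_def)
    also have "\<dots> = (\<Oplus>\<^bsub>W\<^esub> i \<in> F. c \<odot>\<^bsub>W\<^esub> \<phi> i (f i))"
      using F c by (intro W.M.finsum_cong') (auto simp: eq intro!: cl f)
    also have "\<dots> = c \<odot>\<^bsub>W\<^esub> (\<Oplus>\<^bsub>W\<^esub> i \<in> F. \<phi> i (f i))"
      using F c by (intro W.finsum_smult_ldistr[symmetric]) (auto intro!: cl f)
    also have "\<dots> = c \<odot>\<^bsub>W\<^esub> family_copair I V W \<phi> f"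
      by (subst enlarge[OF _ F]) (auto simp: F_def f)
    finally show "family_copair I V W \<phi> (c \<odot>\<^bsub>family_sum I V\<^esub> f) = c \<odot>\<^bsub>W\<^esub> family_copair I V W \<phi> f" .
  qed
qed

lemma family_copair_inj:
  assumes W: "vectorspace K W" and \<phi>: "linear_map K (V i) W (\<phi> i)"
    and i: "i \<in> I" and x: "x \<in> carrier (V i)"
  shows "family_copair I V W \<phi> (family_inj I V i x) = \<phi> i x"
proof -
  interpret W: vectorspace K W by fact
  have cl: "\<phi> i x \<in> carrier W" using linear_map_closed[OF \<phi> x] .
  show ?thesis
  proof (cases "x = \<zero>\<^bsub>V i\<^esub>")
    case True
    then have supp: "{j \<in> I. family_inj I V i x j \<noteq> \<zero>\<^bsub>V j\<^esub>} = {}" by (auto simp: family_inj_def)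
    show ?thesis unfolding family_copair_def supp by (simp add: True linear_map_zero[OF \<phi>])
  next
    case False
    then have "{j \<in> I. family_inj I V i x j \<noteq> \<zero>\<^bsub>V j\<^esub>} = {i}" using i by (auto simp: family_inj_def)
    moreover have "family_inj I V i x i = x" using i by (simp add: family_inj_def)
    ultimately show ?thesis
      using W.M.finsum_insert[of "{}" i "\<lambda>j. \<phi> j (family_inj I V i x j)"] cl
      by (simp add: family_copair_def)
  qed
qed

text \<open>
  Induction on the size of the support: splitting off one summand leaves a family with smaller
  support.
\<close>

lemma family_sum_maps_eq:
  assumes K: "field K" and V: "\<And>i. i \<in> I \<Longrightarrow> vectorspace K (V i)"
    and S: "linear_map K (family_sum I V) W S" and T: "linear_map K (family_sum I V) W T"
    and eq: "\<And>i x. \<lbrakk>i \<in> I; x \<in> carrier (V i)\<rbrakk> \<Longrightarrow> S (family_inj I V i x) = T (family_inj I V i x)"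
    and f: "f \<in> carrier (family_sum I V)"
  shows "S f = T f"
  using f
proof (induction "card {i \<in> I. f i \<noteq> \<zero>\<^bsub>V i\<^esub>}" arbitrary: f rule: less_induct)
  case less
  note f = less.prems
  interpret U: vectorspace K "family_sum I V" by (rule vectorspace_family_sum[OF K V])
  have fin: "finite {i \<in> I. f i \<noteq> \<zero>\<^bsub>V i\<^esub>}" using f by (auto simp: family_sum_def)
  show ?case
  proof (cases "{i \<in> I. f i \<noteq> \<zero>\<^bsub>V i\<^esub>} = {}")
    case True
    then have "f = \<zero>\<^bsub>family_sum I V\<^esub>"
      using f by (auto simp: family_sum_def family_prod_def PiE_iff extensional_def fun_eq_iff)
    then show ?thesis by (simp add: linear_map_zero[OF S] linear_map_zero[OF T])
  next
    case False
    then obtain i where i: "i \<in> I" "f i \<noteq> \<zero>\<^bsub>V i\<^esub>" by auto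
    define g where "g = f(i := \<zero>\<^bsub>V i\<^esub>)"
    have V': "abelian_group (V j)" if "j \<in> I" for j
      using V[OF that] by (simp add: vectorspace_def module_def)
    note am = V'[THEN abelian_group.axioms(1)]
    have fi: "f j \<in> carrier (V j)" if "j \<in> I" for j
      using f that by (auto simp: family_sum_def family_prod_def)
    have sub: "{j \<in> I. g j \<noteq> \<zero>\<^bsub>V j\<^esub>} \<subset> {j \<in> I. f j \<noteq> \<zero>\<^bsub>V j\<^esub>}"
      using i by (auto simp: g_def)
    have g: "g \<in> carrier (family_sum I V)"
      using f i abelian_monoid.zero_closed[OF am] finite_subset[OF psubset_imp_subset[OF sub] fin]
      by (simp add: family_sum_def family_prod_def PiE_iff) (auto simp: g_def extensional_def)
    have inj: "family_inj I V i (f i) \<in> carrier (family_sum I V)"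
      using linear_map_closed[OF linear_map_family_inj[where I = I and V = V, OF K V i(1)] fi[OF i(1)]] .
    have split: "f = g \<oplus>\<^bsub>family_sum I V\<^esub> family_inj I V i (f i)"
    proof
      fix j
      show "f j = (g \<oplus>\<^bsub>family_sum I V\<^esub> family_inj I V i (f i)) j"
        using f fi i(1) abelian_monoid.l_zero[OF am] abelian_monoid.r_zero[OF am]
        by (cases "j \<in> I")
          (auto simp: family_sum_def family_prod_def family_inj_def g_def PiE_iff extensional_def)
    qed
    have "S g = T g" using less.hyps[OF psubset_card_mono[OF fin sub] g] .
    then have "S (g \<oplus>\<^bsub>family_sum I V\<^esub> family_inj I V i (f i)) =
        T (g \<oplus>\<^bsub>family_sum I V\<^esub> family_inj I V i (f i))"
      using linear_map_add[OF S g inj] linear_map_add[OF T g inj] eq[OF i(1) fi[OF i(1)]] by simp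
    then show ?thesis using split by simp
  qed
qed


section \<open>Free vector spaces\<close>

text \<open>The one-dimensional space \<open>K\<close>; a free space is a direct sum of copies of it.\<close>

definition line :: "('k, 'm) ring_scheme \<Rightarrow> ('k, 'k) module" where
  "line K = \<lparr>carrier = carrier K, mult = undefined, one = undefined, zero = \<zero>\<^bsub>K\<^esub>, add = add K,
    smult = mult K\<rparr>"

lemma vectorspace_line:
  assumes K: "field K"
  shows "vectorspace K (line K)"
proof -
  interpret K: field K by fact
  have "\<exists>y\<in>carrier K. x \<oplus>\<^bsub>K\<^esub> y = \<zero>\<^bsub>K\<^esub>" if "x \<in> carrier K" for x
    using that by (intro bexI[of _ "\<ominus>\<^bsub>K\<^esub> x"]) (auto simp: K.r_neg)
  then show ?thesis
    by (intro vs_criteria K) (auto simp: line_def K.a_ac K.m_assoc K.l_distr K.r_distr)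
qed

lemma free_space_sel:
  assumes "field K"
  shows "carrier (free_space K S) = carrier (family_sum S (\<lambda>_. line K))"
    "zero (free_space K S) = zero (family_sum S (\<lambda>_. line K))"
    "add (free_space K S) = add (family_sum S (\<lambda>_. line K))"
    "smult (free_space K S) = smult (family_sum S (\<lambda>_. line K))"
proof -
  interpret K: field K by fact
  show "carrier (free_space K S) = carrier (family_sum S (\<lambda>_. line K))"
    "zero (free_space K S) = zero (family_sum S (\<lambda>_. line K))"
    "add (free_space K S) = add (family_sum S (\<lambda>_. line K))"
    "smult (free_space K S) = smult (family_sum S (\<lambda>_. line K))"
    by (auto simp: free_space_def K.func_space_def family_sum_def family_prod_def line_def)
qed

lemma vectorspace_free_space:
  assumes K: "field K"
  shows "vectorspace K (free_space K S)"
  by (rule vectorspace_cong[OF vectorspace_family_sum[OF K vectorspace_line[OF K]]])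
    (simp_all add: free_space_sel[OF K])

lemma linear_map_free_space_iff:
  assumes K: "field K"
  shows "linear_map K (free_space K S) W T \<longleftrightarrow> linear_map K (family_sum S (\<lambda>_. line K)) W T"
  using vectorspace_free_space[OF K] vectorspace_family_sum[OF K vectorspace_line[OF K]]
  by (auto simp: linear_map_def mod_hom_def mod_hom_axioms_def module_hom_def vectorspace_def
      free_space_sel[OF K])

lemma basis_vec_closed:
  assumes K: "field K" and s: "s \<in> S"
  shows "basis_vec K S s \<in> carrier (free_space K S)"
proof -
  interpret K: field K by fact
  have "finite {t \<in> S. basis_vec K S s t \<noteq> \<zero>\<^bsub>K\<^esub>}"
    by (rule finite_subset[of _ "{s}"]) (auto simp: basis_vec_def)
  then show ?thesis by (auto simp: free_space_def basis_vec_def)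
qed

lemma linear_map_line:
  assumes W: "vectorspace K W" and b: "b \<in> carrier W"
  shows "linear_map K (line K) W (\<lambda>k. k \<odot>\<^bsub>W\<^esub> b)"
proof -
  interpret W: vectorspace K W by fact
  show ?thesis
    by (intro linear_mapI vectorspace_line W.field_axioms W)
      (use b in \<open>simp_all add: line_def W.smult_l_distr W.smult_assoc1\<close>)
qed

lemma lin_extend_copair:
  "lin_extend K S V b = family_copair S (\<lambda>_. line K) V (\<lambda>s k. k \<odot>\<^bsub>V\<^esub> b s)"
  by (simp add: lin_extend_def family_copair_def line_def fun_eq_iff)

lemma linear_map_lin_extend:
  assumes K: "field K" and V: "vectorspace K V" and b: "\<And>s. s \<in> S \<Longrightarrow> b s \<in> carrier V"
  shows "linear_map K (free_space K S) V (lin_extend K S V b)"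
  unfolding linear_map_free_space_iff[OF K] lin_extend_copair
  by (intro linear_map_family_copair K V linear_map_line b)

lemma lin_extend_basis:
  assumes K: "field K" and V: "vectorspace K V" and b: "b s \<in> carrier V" and s: "s \<in> S"
  shows "lin_extend K S V b (basis_vec K S s) = b s"
proof -
  interpret V: vectorspace K V by fact
  have "basis_vec K S s = family_inj S (\<lambda>_. line K) s \<one>\<^bsub>K\<^esub>"
    by (auto simp: basis_vec_def family_inj_def line_def)
  then show ?thesis
    unfolding lin_extend_copair
    using family_copair_inj[where V = "\<lambda>_. line K" and \<phi> = "\<lambda>s k. k \<odot>\<^bsub>V\<^esub> b s", OF V
        linear_map_line[OF V b] s] b
    by (simp add: line_def)
qed

lemma free_space_maps_eq:
  assumes K: "field K"
    and S: "linear_map K (free_space K B) W S" and T: "linear_map K (free_space K B) W T"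
    and eq: "\<And>s. s \<in> B \<Longrightarrow> S (basis_vec K B s) = T (basis_vec K B s)"
    and f: "f \<in> carrier (free_space K B)"
  shows "S f = T f"
proof (rule family_sum_maps_eq[where V = "\<lambda>_. line K" and I = B, OF K vectorspace_line[OF K]])
  show "linear_map K (family_sum B (\<lambda>_. line K)) W S" "linear_map K (family_sum B (\<lambda>_. line K)) W T"
    using S T by (simp_all add: linear_map_free_space_iff[OF K])
  show "f \<in> carrier (family_sum B (\<lambda>_. line K))" using f by (simp add: free_space_sel[OF K])
  fix s x assume s: "s \<in> B" and x: "x \<in> carrier (line K)"
  interpret K: field K by fact
  have xK: "x \<in> carrier K" using x by (simp add: line_def)
  have "family_inj B (\<lambda>_. line K) s x = x \<odot>\<^bsub>free_space K B\<^esub> basis_vec K B s"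
    using xK by (auto simp: family_inj_def line_def free_space_def K.func_space_def basis_vec_def)
  then show "S (family_inj B (\<lambda>_. line K) s x) = T (family_inj B (\<lambda>_. line K) s x)"
    using linear_map_smult[OF S xK basis_vec_closed[OF K s]]
      linear_map_smult[OF T xK basis_vec_closed[OF K s]] eq[OF s] by simp
qed


section \<open>Singular homology over a field is a functor\<close>

lemma vectorspace_chain_space: "field K \<Longrightarrow> vectorspace K (chain_space K p X)"
  by (simp add: chain_space_def vectorspace_free_space)

lemma basis_in_chain_space:
  "\<lbrakk>field K; singular_simplex p X s\<rbrakk>
    \<Longrightarrow> basis_vec K (singular_simplex_set p X) s \<in> carrier (chain_space K p X)"
  by (simp add: chain_space_def basis_vec_closed)

text \<open>All identities between chain maps are checked on singular simplices.\<close>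

lemma chain_maps_eq:
  assumes "field K" "linear_map K (chain_space K p X) W S" "linear_map K (chain_space K p X) W T"
    and "\<And>s. singular_simplex p X s \<Longrightarrow>
      S (basis_vec K (singular_simplex_set p X) s) = T (basis_vec K (singular_simplex_set p X) s)"
    and "c \<in> carrier (chain_space K p X)"
  shows "S c = T c"
  using free_space_maps_eq[OF assms(1) assms(2,3)[unfolded chain_space_def] _
      assms(5)[unfolded chain_space_def]] assms(4)
  by simp

lemma face_sum_closed:
  assumes K: "field K" and p: "p \<noteq> 0" and s: "singular_simplex p X s" and k: "k \<le> p"
  shows "((\<ominus>\<^bsub>K\<^esub> \<one>\<^bsub>K\<^esub>) [^]\<^bsub>K\<^esub> (k :: nat)) \<odot>\<^bsub>chain_space K (p - 1) X\<^esub>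
    basis_vec K (singular_simplex_set (p - 1) X) (singular_face p k s)
      \<in> carrier (chain_space K (p - 1) X)"
proof -
  interpret C: vectorspace K "chain_space K (p - 1) X" by (rule vectorspace_chain_space[OF K])
  have "singular_simplex (p - 1) X (singular_face p k s)"
    using singular_simplex_singular_face[OF s] p k by simp
  then show ?thesis by (intro C.smult_closed basis_in_chain_space[OF K]) simp_all
qed

lemma linear_map_boundary:
  assumes K: "field K"
  shows "linear_map K (chain_space K p X) (chain_space K (p - 1) X) (boundary K p X)"
proof (cases "p = 0")
  case True
  then show ?thesis
    using linear_map_zero_map[OF vectorspace_chain_space[OF K] vectorspace_chain_space[OF K]]
    by (simp add: boundary_def)
next
  case False
  interpret C: vectorspace K "chain_space K (p - 1) X" by (rule vectorspace_chain_space[OF K])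
  show ?thesis
    unfolding boundary_def if_not_P[OF False] chain_space_def[of K p]
    by (intro linear_map_lin_extend K C.vectorspace_axioms C.M.finsum_closed Pi_I
        face_sum_closed[OF K False]) simp_all
qed

lemma boundary_basis:
  assumes K: "field K" and p: "p \<noteq> 0" and s: "singular_simplex p X s"
  shows "boundary K p X (basis_vec K (singular_simplex_set p X) s) =
    (\<Oplus>\<^bsub>chain_space K (p - 1) X\<^esub> k \<in> {..p}. ((\<ominus>\<^bsub>K\<^esub> \<one>\<^bsub>K\<^esub>) [^]\<^bsub>K\<^esub> k) \<odot>\<^bsub>chain_space K (p - 1) X\<^esub>
          basis_vec K (singular_simplex_set (p - 1) X) (singular_face p k s))"
proof -
  interpret C: vectorspace K "chain_space K (p - 1) X" by (rule vectorspace_chain_space[OF K])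
  show ?thesis
    unfolding boundary_def if_not_P[OF p]
    by (intro lin_extend_basis K C.vectorspace_axioms C.M.finsum_closed Pi_I face_sum_closed p s)
      (simp_all add: s)
qed

text \<open>
  That the boundary of a boundary vanishes is inherited from integral chains, along the
  homomorphism that reduces the coefficients of an integral chain to multiples of the unit of
  \<open>K\<close>.
\<close>

definition chain_coeffs ::
  "('k, 'm) ring_scheme \<Rightarrow> nat \<Rightarrow> 'a topology \<Rightarrow> 'a chain \<Rightarrow> 'a sing \<Rightarrow> 'k" where
  "chain_coeffs K p X c =
    (\<lambda>s \<in> singular_simplex_set p X. [Poly_Mapping.lookup c s] \<cdot>\<^bsub>K\<^esub> \<one>\<^bsub>K\<^esub>)"

lemma int_multiple_zero: "[(0 :: int)] \<cdot>\<^bsub>R\<^esub> a = \<zero>\<^bsub>R\<^esub>"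
  by (simp add: add_pow_def int_pow_def nat_pow_def)

lemma chain_coeffs_closed:
  assumes K: "field K"
  shows "chain_coeffs K p X c \<in> carrier (chain_space K p X)"
proof -
  interpret K: field K by fact
  have "finite {s \<in> singular_simplex_set p X. chain_coeffs K p X c s \<noteq> \<zero>\<^bsub>K\<^esub>}"
    by (rule finite_subset[of _ "Poly_Mapping.keys c"])
      (auto simp: chain_coeffs_def in_keys_iff int_multiple_zero)
  then show ?thesis
    by (auto simp: chain_space_def free_space_def chain_coeffs_def)
qed

lemma chain_coeffs_zero:
  assumes K: "field K"
  shows "chain_coeffs K p X 0 = \<zero>\<^bsub>chain_space K p X\<^esub>"
proof -
  interpret K: field K by fact
  show ?thesis by (auto simp: chain_coeffs_def chain_space_def free_space_def K.func_space_def
        int_multiple_zero)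
qed

lemma chain_coeffs_add:
  assumes K: "field K"
  shows "chain_coeffs K p X (a + b) = chain_coeffs K p X a \<oplus>\<^bsub>chain_space K p X\<^esub> chain_coeffs K p X b"
proof -
  interpret K: field K by fact
  show ?thesis
    by (auto simp: chain_coeffs_def chain_space_def free_space_def K.func_space_def lookup_add
        K.add.int_pow_mult)
qed

lemma chain_coeffs_diff:
  assumes K: "field K"
  shows "chain_coeffs K p X (a - b) = chain_coeffs K p X a \<ominus>\<^bsub>chain_space K p X\<^esub> chain_coeffs K p X b"
proof -
  interpret C: vectorspace K "chain_space K p X" by (rule vectorspace_chain_space[OF K])
  show ?thesis
    using chain_coeffs_add[OF K, of p X "a - b" b] chain_coeffs_closed[OF K, of p X]
    by (simp add: a_minus_def C.M.a_assoc C.M.r_neg)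
qed

lemma chain_coeffs_sum:
  assumes K: "field K"
  shows "chain_coeffs K p X (\<Sum>i\<in>A. f i) = (\<Oplus>\<^bsub>chain_space K p X\<^esub> i \<in> A. chain_coeffs K p X (f i))"
proof -
  interpret C: vectorspace K "chain_space K p X" by (rule vectorspace_chain_space[OF K])
  show ?thesis
    by (induct A rule: infinite_finite_induct)
      (simp_all add: chain_coeffs_zero[OF K] chain_coeffs_add[OF K] chain_coeffs_closed[OF K])
qed

lemma chain_coeffs_signed_simplex:
  assumes K: "field K"
  shows "chain_coeffs K p X (frag_cmul ((-1) ^ k) (frag_of s)) =
    ((\<ominus>\<^bsub>K\<^esub> \<one>\<^bsub>K\<^esub>) [^]\<^bsub>K\<^esub> k) \<odot>\<^bsub>chain_space K p X\<^esub> basis_vec K (singular_simplex_set p X) s"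
proof -
  interpret K: field K by fact
  have pow: "[((-1) ^ k :: int)] \<cdot>\<^bsub>K\<^esub> \<one>\<^bsub>K\<^esub> = (\<ominus>\<^bsub>K\<^esub> \<one>\<^bsub>K\<^esub>) [^]\<^bsub>K\<^esub> k"
  proof (induct k)
    case (Suc k)
    have "[((-1) ^ Suc k :: int)] \<cdot>\<^bsub>K\<^esub> \<one>\<^bsub>K\<^esub> = \<ominus>\<^bsub>K\<^esub> ([((-1) ^ k :: int)] \<cdot>\<^bsub>K\<^esub> \<one>\<^bsub>K\<^esub>)"
      by (simp add: K.add.int_pow_neg)
    then show ?case by (simp add: Suc K.r_minus)
  qed (simp add: K.add.int_pow_1)
  show ?thesis
    by (auto simp: chain_coeffs_def chain_space_def free_space_def K.func_space_def basis_vec_def pow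
        int_multiple_zero intro!: restrict_ext)
qed

lemma chain_coeffs_simplex:
  assumes K: "field K"
  shows "chain_coeffs K p X (frag_of s) = basis_vec K (singular_simplex_set p X) s"
proof -
  interpret K: field K by fact
  show ?thesis
    by (auto simp: chain_coeffs_def basis_vec_def int_multiple_zero intro!: restrict_ext)
qed

text \<open>
  Both sides are additive in \<open>c\<close>, and on a single simplex both are the alternating sum of its faces.
\<close>

lemma boundary_chain_coeffs:
  assumes K: "field K" and c: "singular_chain p X c"
  shows "boundary K p X (chain_coeffs K p X c) = chain_coeffs K (p - 1) X (chain_boundary p c)"
proof (cases "p = 0")
  case True
  then show ?thesis by (simp add: boundary_def chain_boundary_def chain_coeffs_zero[OF K])
next
  case False
  show ?thesis using c unfolding singular_chain_def
  proof (induction rule: frag_induction)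
    case zero
    then show ?case
      by (simp add: chain_coeffs_zero[OF K] linear_map_zero[OF linear_map_boundary[OF K], simplified])
  next
    case (one s)
    then show ?case
      using False
      by (simp add: chain_coeffs_simplex[OF K] boundary_basis[OF K False] chain_boundary_of
          chain_coeffs_sum[OF K] chain_coeffs_signed_simplex[OF K])
  next
    case (diff a b)
    then show ?case
      by (simp add: chain_boundary_diff chain_coeffs_diff[OF K] chain_coeffs_closed[OF K]
          linear_map_minus[OF linear_map_boundary[OF K], simplified])
  qed
qed

lemma boundary_boundary:
  assumes K: "field K" and c: "c \<in> carrier (chain_space K (Suc p) X)"
  shows "boundary K p X (boundary K (Suc p) X c) = \<zero>\<^bsub>chain_space K (p - 1) X\<^esub>"
proof (rule chain_maps_eq[OF K _ _ _ c])
  have "linear_map K (chain_space K (Suc p) X) (chain_space K p X) (boundary K (Suc p) X)"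
    using linear_map_boundary[OF K, of "Suc p" X] by simp
  from linear_map_comp[OF this linear_map_boundary[OF K]]
  show "linear_map K (chain_space K (Suc p) X) (chain_space K (p - 1) X)
    (\<lambda>c. boundary K p X (boundary K (Suc p) X c))" .
  show "linear_map K (chain_space K (Suc p) X) (chain_space K (p - 1) X)
    (\<lambda>c. \<zero>\<^bsub>chain_space K (p - 1) X\<^esub>)"
    by (intro linear_map_zero_map vectorspace_chain_space K)
  fix s assume s: "singular_simplex (Suc p) X s"
  then have "singular_chain (Suc p) X (frag_of s)" by (simp add: singular_chain_of)
  then show "boundary K p X (boundary K (Suc p) X (basis_vec K (singular_simplex_set (Suc p) X) s)) =
      \<zero>\<^bsub>chain_space K (p - 1) X\<^esub>"
    using chain_boundary_boundary_alt[of p X "frag_of s"] singular_chain_boundary_alt[of p X "frag_of s"]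
    by (simp add: boundary_chain_coeffs[OF K] chain_coeffs_zero[OF K]
        flip: chain_coeffs_simplex[OF K])
qed

lemma subspace_cycles:
  assumes K: "field K"
  shows "subspace K (carrier (cycle_space K p X)) (chain_space K p X)"
  using subspace_kernel[OF linear_map_boundary[OF K, of p X]] by (simp add: cycle_space_def)

lemma subspace_boundaries:
  assumes K: "field K"
  shows "subspace K (boundary_space K p X) (cycle_space K p X)"
proof -
  have B: "linear_map K (chain_space K (Suc p) X) (chain_space K p X) (boundary K (Suc p) X)"
    using linear_map_boundary[OF K, of "Suc p" X] by simp
  have "boundary K (Suc p) X c \<in> carrier (cycle_space K p X)"
    if "c \<in> carrier (chain_space K (Suc p) X)" for c
    using that linear_map_closed[OF B that] boundary_boundary[OF K that]
    by (simp add: cycle_space_def)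
  from linear_map_into_subspace[OF B subspace_cycles[OF K] this]
  have "linear_map K (chain_space K (Suc p) X) (cycle_space K p X) (boundary K (Suc p) X)"
    by (simp add: cycle_space_def)
  then show ?thesis unfolding boundary_space_def by (rule subspace_image)
qed

lemma vectorspace_homology: "field K \<Longrightarrow> vectorspace K (homology K p X)"
  unfolding homology_def by (rule vectorspace_quotient[OF subspace_boundaries])

lemma linear_map_chain_push:
  assumes K: "field K" and g: "continuous_map X Y g"
  shows "linear_map K (chain_space K p X) (chain_space K p Y) (chain_push K p X Y g)"
  unfolding chain_push_def chain_space_def[of K p X]
  by (intro linear_map_lin_extend K vectorspace_chain_space basis_in_chain_space)
    (simp_all add: singular_simplex_simplex_map[OF _ g])

lemma chain_push_basis:
  assumes K: "field K" and g: "continuous_map X Y g" and s: "singular_simplex p X s"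
  shows "chain_push K p X Y g (basis_vec K (singular_simplex_set p X) s) =
    basis_vec K (singular_simplex_set p Y) (simplex_map p g s)"
  unfolding chain_push_def
  by (rule lin_extend_basis[OF K vectorspace_chain_space[OF K]])
    (use s in \<open>simp_all add: basis_in_chain_space[OF K] singular_simplex_simplex_map[OF s g]\<close>)

lemma chain_push_id:
  assumes K: "field K" and c: "c \<in> carrier (chain_space K p X)"
  shows "chain_push K p X X id c = c"
proof (rule chain_maps_eq[OF K _ _ _ c, where T = "\<lambda>c. c"])
  show "linear_map K (chain_space K p X) (chain_space K p X) (chain_push K p X X id)"
    by (intro linear_map_chain_push K) simp
  show "linear_map K (chain_space K p X) (chain_space K p X) (\<lambda>c. c)"
    by (rule linear_mapI) (simp_all add: vectorspace_chain_space[OF K])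
  fix s assume "singular_simplex p X s"
  then show "chain_push K p X X id (basis_vec K (singular_simplex_set p X) s) =
      basis_vec K (singular_simplex_set p X) s"
    using simplex_map_id_gen[of p X s id]
    by (simp add: chain_push_basis[OF K] del: simplex_map_id)
qed

lemma chain_push_comp:
  assumes K: "field K" and g: "continuous_map X Y g" and h: "continuous_map Y Z h"
    and c: "c \<in> carrier (chain_space K p X)"
  shows "chain_push K p Y Z h (chain_push K p X Y g c) = chain_push K p X Z (h \<circ> g) c"
proof (rule chain_maps_eq[OF K _ _ _ c])
  note hg = continuous_map_compose[OF g h]
  show "linear_map K (chain_space K p X) (chain_space K p Z)
      (\<lambda>c. chain_push K p Y Z h (chain_push K p X Y g c))"
    by (rule linear_map_comp[OF linear_map_chain_push[OF K g] linear_map_chain_push[OF K h]])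
  show "linear_map K (chain_space K p X) (chain_space K p Z) (chain_push K p X Z (h \<circ> g))"
    by (rule linear_map_chain_push[OF K hg])
  fix s assume s: "singular_simplex p X s"
  then show "chain_push K p Y Z h (chain_push K p X Y g (basis_vec K (singular_simplex_set p X) s)) =
      chain_push K p X Z (h \<circ> g) (basis_vec K (singular_simplex_set p X) s)"
    by (simp add: chain_push_basis[OF K g] chain_push_basis[OF K h] chain_push_basis[OF K hg]
        singular_simplex_simplex_map[OF s g] simplex_map_compose)
qed

lemma singular_face_push:
  assumes "p \<noteq> 0" "k \<le> p"
  shows "singular_face p k (simplex_map p g s) = simplex_map (p - 1) g (singular_face p k s)"
  using assms by (simp add: singular_face_simplex_map) (auto simp: simplex_map_def singular_face_def)

text \<open>On a simplex, this is the compatibility of faces with composition.\<close>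

lemma boundary_chain_push:
  assumes K: "field K" and g: "continuous_map X Y g" and c: "c \<in> carrier (chain_space K p X)"
  shows "boundary K p Y (chain_push K p X Y g c) = chain_push K (p - 1) X Y g (boundary K p X c)"
proof (cases "p = 0")
  case True
  then show ?thesis
    using linear_map_zero[OF linear_map_chain_push[OF K g, of 0]] by (simp add: boundary_def)
next
  case False
  interpret C: vectorspace K "chain_space K (p - 1) X" by (rule vectorspace_chain_space[OF K])
  interpret D: vectorspace K "chain_space K (p - 1) Y" by (rule vectorspace_chain_space[OF K])
  note P = linear_map_chain_push[OF K g]
  show ?thesis
  proof (rule chain_maps_eq[OF K _ _ _ c])
    show "linear_map K (chain_space K p X) (chain_space K (p - 1) Y)
        (\<lambda>c. boundary K p Y (chain_push K p X Y g c))"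
      by (rule linear_map_comp[OF P linear_map_boundary[OF K]])
    show "linear_map K (chain_space K p X) (chain_space K (p - 1) Y)
        (\<lambda>c. chain_push K (p - 1) X Y g (boundary K p X c))"
      by (rule linear_map_comp[OF linear_map_boundary[OF K] P])
    fix s assume s: "singular_simplex p X s"
    have face: "singular_simplex (p - 1) X (singular_face p k s)" if "k \<le> p" for k
      using singular_simplex_singular_face[OF s] False that by simp
    have gs: "singular_simplex p Y (simplex_map p g s)"
      by (rule singular_simplex_simplex_map[OF s g])
    have "chain_push K (p - 1) X Y g (boundary K p X (basis_vec K (singular_simplex_set p X) s)) =
        (\<Oplus>\<^bsub>chain_space K (p - 1) Y\<^esub> k \<in> {..p}. chain_push K (p - 1) X Y g
          (((\<ominus>\<^bsub>K\<^esub> \<one>\<^bsub>K\<^esub>) [^]\<^bsub>K\<^esub> k) \<odot>\<^bsub>chain_space K (p - 1) X\<^esub>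
            basis_vec K (singular_simplex_set (p - 1) X) (singular_face p k s)))"
      unfolding boundary_basis[OF K False s]
      by (rule linear_map_finsum[OF P]) (use face_sum_closed[OF K False s] in auto)
    also have "\<dots> = (\<Oplus>\<^bsub>chain_space K (p - 1) Y\<^esub> k \<in> {..p}.
        ((\<ominus>\<^bsub>K\<^esub> \<one>\<^bsub>K\<^esub>) [^]\<^bsub>K\<^esub> k) \<odot>\<^bsub>chain_space K (p - 1) Y\<^esub>
          basis_vec K (singular_simplex_set (p - 1) Y) (singular_face p k (simplex_map p g s)))"
    proof (rule D.M.finsum_cong'[OF refl])
      show "(\<lambda>k. ((\<ominus>\<^bsub>K\<^esub> \<one>\<^bsub>K\<^esub>) [^]\<^bsub>K\<^esub> k) \<odot>\<^bsub>chain_space K (p - 1) Y\<^esub>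
          basis_vec K (singular_simplex_set (p - 1) Y) (singular_face p k (simplex_map p g s)))
            \<in> {..p} \<rightarrow> carrier (chain_space K (p - 1) Y)"
        using face_sum_closed[OF K False gs] by auto
      fix k assume "k \<in> {..p}"
      then show "chain_push K (p - 1) X Y g (((\<ominus>\<^bsub>K\<^esub> \<one>\<^bsub>K\<^esub>) [^]\<^bsub>K\<^esub> k) \<odot>\<^bsub>chain_space K (p - 1) X\<^esub>
            basis_vec K (singular_simplex_set (p - 1) X) (singular_face p k s)) =
          ((\<ominus>\<^bsub>K\<^esub> \<one>\<^bsub>K\<^esub>) [^]\<^bsub>K\<^esub> k) \<odot>\<^bsub>chain_space K (p - 1) Y\<^esub>
            basis_vec K (singular_simplex_set (p - 1) Y) (singular_face p k (simplex_map p g s))"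
        using face[of k] False
        by (simp add: linear_map_smult[OF P] basis_in_chain_space[OF K] chain_push_basis[OF K g]
            singular_face_push)
    qed
    also have "\<dots> = boundary K p Y (chain_push K p X Y g (basis_vec K (singular_simplex_set p X) s))"
      by (simp only: boundary_basis[OF K False gs] chain_push_basis[OF K g s])
    finally show "boundary K p Y (chain_push K p X Y g (basis_vec K (singular_simplex_set p X) s)) =
        chain_push K (p - 1) X Y g (boundary K p X (basis_vec K (singular_simplex_set p X) s))"
      by (rule sym)
  qed
qed

lemma linear_map_cycle_push:
  assumes K: "field K" and g: "continuous_map X Y g"
  shows "linear_map K (cycle_space K p X) (cycle_space K p Y) (chain_push K p X Y g)"
proof -
  note P = linear_map_chain_push[OF K g]
  have "linear_map K (cycle_space K p X) (chain_space K p Y) (chain_push K p X Y g)"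
    using linear_map_on_subspace[OF P subspace_cycles[OF K]] by (simp add: cycle_space_def)
  from linear_map_into_subspace[OF this subspace_cycles[OF K]]
  have "linear_map K (cycle_space K p X) (chain_space K p Y\<lparr>carrier := carrier (cycle_space K p Y)\<rparr>)
      (chain_push K p X Y g)"
    using linear_map_zero[OF P]
    by (simp add: cycle_space_def linear_map_closed[OF P] boundary_chain_push[OF K g])
  then show ?thesis by (simp add: cycle_space_def)
qed

lemma boundary_space_push:
  assumes K: "field K" and g: "continuous_map X Y g" and b: "b \<in> boundary_space K p X"
  shows "chain_push K p X Y g b \<in> boundary_space K p Y"
proof -
  obtain c where c: "c \<in> carrier (chain_space K (Suc p) X)" and b: "b = boundary K (Suc p) X c"
    using b by (auto simp: boundary_space_def)
  have "chain_push K p X Y g b = boundary K (Suc p) Y (chain_push K (Suc p) X Y g c)"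
    using boundary_chain_push[OF K g c] by (simp add: b)
  then show ?thesis
    using linear_map_closed[OF linear_map_chain_push[OF K g] c] by (auto simp: boundary_space_def)
qed

lemma homology_map_class:
  assumes K: "field K" and g: "continuous_map X Y g" and c: "c \<in> carrier (cycle_space K p X)"
  shows "homology_map K p X Y g (boundary_space K p X +>\<^bsub>cycle_space K p X\<^esub> c) =
    boundary_space K p Y +>\<^bsub>cycle_space K p Y\<^esub> chain_push K p X Y g c"
proof -
  note BX = subspace_boundaries[OF K, of p X] and BY = subspace_boundaries[OF K, of p Y]
  have "linear_map K (cycle_space K p X) (homology K p Y)
      (\<lambda>c. boundary_space K p Y +>\<^bsub>cycle_space K p Y\<^esub> chain_push K p X Y g c)"
    unfolding homology_def
    by (rule linear_map_comp[OF linear_map_cycle_push[OF K g] linear_map_coset[OF BY]])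
  moreover have "boundary_space K p Y +>\<^bsub>cycle_space K p Y\<^esub> chain_push K p X Y g b = \<zero>\<^bsub>homology K p Y\<^esub>"
    if "b \<in> boundary_space K p X" for b
    using abelian_subgroup.a_rcos_const[OF abelian_subgroup_subspace[OF BY]
        boundary_space_push[OF K g that]]
    by (simp add: homology_def quotient_space_def)
  ultimately have "(\<lambda>c. boundary_space K p Y +>\<^bsub>cycle_space K p Y\<^esub> chain_push K p X Y g c) `
      (boundary_space K p X +>\<^bsub>cycle_space K p X\<^esub> c) =
      {boundary_space K p Y +>\<^bsub>cycle_space K p Y\<^esub> chain_push K p X Y g c}"
    by (rule linear_image_coset[OF BX _ _ c])
  then show ?thesis by (simp add: homology_map_def)
qed

lemma linear_map_homology_map:
  assumes K: "field K" and g: "continuous_map X Y g"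
  shows "linear_map K (homology K p X) (homology K p Y) (homology_map K p X Y g)"
  unfolding homology_def
  by (rule linear_map_from_quotient[OF subspace_boundaries[OF K]
        linear_map_comp[OF linear_map_cycle_push[OF K g] linear_map_coset[OF subspace_boundaries[OF K]]]])
    (rule homology_map_class[OF K g])

lemma homology_cases:
  assumes "x \<in> carrier (homology K p X)"
  obtains c where "c \<in> carrier (cycle_space K p X)" "x = boundary_space K p X +>\<^bsub>cycle_space K p X\<^esub> c"
  using assms unfolding homology_def by (rule coset_cases)

lemma homology_map_id:
  assumes K: "field K" and x: "x \<in> carrier (homology K p X)"
  shows "homology_map K p X X id x = x"
proof -
  obtain c where c: "c \<in> carrier (cycle_space K p X)"
    and x: "x = boundary_space K p X +>\<^bsub>cycle_space K p X\<^esub> c"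
    using homology_cases[OF x] .
  have "c \<in> carrier (chain_space K p X)" using c by (simp add: cycle_space_def)
  then show ?thesis by (simp add: x homology_map_class[OF K _ c] chain_push_id[OF K])
qed

lemma homology_map_comp:
  assumes K: "field K" and g: "continuous_map X Y g" and h: "continuous_map Y Z h"
    and x: "x \<in> carrier (homology K p X)"
  shows "homology_map K p Y Z h (homology_map K p X Y g x) = homology_map K p X Z (h \<circ> g) x"
proof -
  obtain c where c: "c \<in> carrier (cycle_space K p X)"
    and x: "x = boundary_space K p X +>\<^bsub>cycle_space K p X\<^esub> c"
    using homology_cases[OF x] .
  have "c \<in> carrier (chain_space K p X)" using c by (simp add: cycle_space_def)
  then show ?thesis
    using linear_map_closed[OF linear_map_cycle_push[OF K g] c]
    by (simp add: x homology_map_class[OF K g c] homology_map_class[OF K h]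
        homology_map_class[OF K continuous_map_compose[OF g h] c] chain_push_comp[OF K g h])
qed


section \<open>Colimits and limits of diagrams of vector spaces\<close>

lemma
  assumes "vect_functor K I R D"
  shows functor_ob: "i \<in> I \<Longrightarrow> vectorspace K (ob D i)"
    and functor_arr: "\<lbrakk>i \<in> I; j \<in> I; R i j\<rbrakk> \<Longrightarrow> linear_map K (ob D i) (ob D j) (arr D i j)"
    and functor_id: "\<lbrakk>i \<in> I; x \<in> carrier (ob D i)\<rbrakk> \<Longrightarrow> arr D i i x = x"
    and functor_comp: "\<lbrakk>i \<in> I; j \<in> I; k \<in> I; R i j; R j k; x \<in> carrier (ob D i)\<rbrakk>
      \<Longrightarrow> arr D j k (arr D i j x) = arr D i k x"
    and functor_subset: "J \<subseteq> I \<Longrightarrow> vect_functor K J R D"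
  using assms unfolding vect_functor_def by (simp_all, blast)

lemma vect_functorI:
  assumes "\<And>i. i \<in> I \<Longrightarrow> vectorspace K (ob D i)"
    and "\<And>i j. \<lbrakk>i \<in> I; j \<in> I; R i j\<rbrakk> \<Longrightarrow> linear_map K (ob D i) (ob D j) (arr D i j)"
    and "\<And>i x. \<lbrakk>i \<in> I; x \<in> carrier (ob D i)\<rbrakk> \<Longrightarrow> arr D i i x = x"
    and "\<And>i j k x. \<lbrakk>i \<in> I; j \<in> I; k \<in> I; R i j; R j k; x \<in> carrier (ob D i)\<rbrakk>
      \<Longrightarrow> arr D j k (arr D i j x) = arr D i k x"
  shows "vect_functor K I R D"
  using assms unfolding vect_functor_def by simp

locale vect_diagram =
  fixes K :: "('k, 'm) ring_scheme" and I :: "'i set" and R :: "'i \<Rightarrow> 'i \<Rightarrow> bool"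
    and D :: "('i, 'k, 'v) diagram"
  assumes field: "field K" and diagram: "vect_functor K I R D"
begin

lemma family_inj_closed: "\<lbrakk>i \<in> I; x \<in> carrier (ob D i)\<rbrakk>
    \<Longrightarrow> family_inj I (ob D) i x \<in> carrier (family_sum I (ob D))"
  using linear_map_closed[OF linear_map_family_inj[where V = "ob D" and I = I,
        OF field functor_ob[OF diagram]]] .

lemma relations_closed:
  "{family_inj I (ob D) i x \<ominus>\<^bsub>family_sum I (ob D)\<^esub> family_inj I (ob D) j (arr D i j x) | i j x.
      i \<in> I \<and> j \<in> I \<and> R i j \<and> x \<in> carrier (ob D i)} \<subseteq> carrier (family_sum I (ob D))"
proof -
  interpret S: vectorspace K "family_sum I (ob D)"
    by (rule vectorspace_family_sum[OF field functor_ob[OF diagram]])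
  show ?thesis
    by (auto intro!: S.M.minus_closed family_inj_closed linear_map_closed[OF functor_arr[OF diagram]])
qed

lemma subspace_colim_relations:
  "subspace K (colim_relations K I R D) (family_sum I (ob D))"
proof -
  interpret S: vectorspace K "family_sum I (ob D)"
    by (rule vectorspace_family_sum[OF field functor_ob[OF diagram]])
  show ?thesis
    unfolding colim_relations_def by (rule S.span_is_subspace[OF relations_closed])
qed

lemma vectorspace_colim: "vectorspace K (colim K I R D)"
  unfolding colim_def by (rule vectorspace_quotient[OF subspace_colim_relations])

lemma linear_map_colim_inj:
  assumes "i \<in> I"
  shows "linear_map K (ob D i) (colim K I R D) (colim_inj K I R D i)"
  using linear_map_comp[OF linear_map_family_inj[where V = "ob D" and I = I,
        OF field functor_ob[OF diagram] assms] linear_map_coset[OF subspace_colim_relations]]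
  by (simp add: colim_def colim_inj_def[abs_def])

lemma colim_inj_arr:
  assumes i: "i \<in> I" and j: "j \<in> I" and R: "R i j" and x: "x \<in> carrier (ob D i)"
  shows "colim_inj K I R D j (arr D i j x) = colim_inj K I R D i x"
proof -
  interpret S: vectorspace K "family_sum I (ob D)"
    by (rule vectorspace_family_sum[OF field functor_ob[OF diagram]])
  have "family_inj I (ob D) i x \<ominus>\<^bsub>family_sum I (ob D)\<^esub> family_inj I (ob D) j (arr D i j x)
      \<in> colim_relations K I R D"
    unfolding colim_relations_def
    by (rule subsetD[OF S.in_own_span[OF relations_closed]]) (use assms in blast)
  then show ?thesis
    unfolding colim_inj_def
    by (intro coset_eq[OF subspace_colim_relations, symmetric] family_inj_closed i j x
        linear_map_closed[OF functor_arr[OF diagram i j R] x])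
qed

text \<open>Uniqueness in the universal property: the coprojections are jointly epimorphic.\<close>

lemma colim_maps_eq:
  assumes S: "linear_map K (colim K I R D) W S" and T: "linear_map K (colim K I R D) W T"
    and eq: "\<And>i x. \<lbrakk>i \<in> I; x \<in> carrier (ob D i)\<rbrakk>
      \<Longrightarrow> S (colim_inj K I R D i x) = T (colim_inj K I R D i x)"
    and c: "c \<in> carrier (colim K I R D)"
  shows "S c = T c"
proof -
  obtain f where f: "f \<in> carrier (family_sum I (ob D))"
    and c: "c = colim_relations K I R D +>\<^bsub>family_sum I (ob D)\<^esub> f"
    using c unfolding colim_def by (rule coset_cases)
  note Q = linear_map_coset[OF subspace_colim_relations, folded colim_def]
  show ?thesis
    unfolding c
    by (rule family_sum_maps_eq[where V = "ob D" and I = I, OF field functor_ob[OF diagram]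
          linear_map_comp[OF Q S] linear_map_comp[OF Q T] _ f])
      (simp_all add: eq flip: colim_inj_def)
qed

text \<open>
  The universal property of the colimit. The map \<open>?T\<close> out of the direct sum that the cocone
  induces vanishes on the generators \<open>x - D(i \<rightarrow> j) x\<close> of the relations, hence on their span, and
  so it is constant on cosets.
\<close>

lemma
  assumes W: "vectorspace K W"
    and \<phi>: "\<And>i. i \<in> I \<Longrightarrow> linear_map K (ob D i) W (\<phi> i)"
    and cocone: "\<And>i j x. \<lbrakk>i \<in> I; j \<in> I; R i j; x \<in> carrier (ob D i)\<rbrakk>
      \<Longrightarrow> \<phi> j (arr D i j x) = \<phi> i x"
  shows linear_map_colim_desc: "linear_map K (colim K I R D) W (colim_desc I D W \<phi>)"
    and colim_desc_inj: "\<lbrakk>i \<in> I; x \<in> carrier (ob D i)\<rbrakk>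
      \<Longrightarrow> colim_desc I D W \<phi> (colim_inj K I R D i x) = \<phi> i x"
proof -
  interpret S: vectorspace K "family_sum I (ob D)"
    by (rule vectorspace_family_sum[OF field functor_ob[OF diagram]])
  interpret W: vectorspace K W by fact
  let ?T = "family_copair I (ob D) W \<phi>"
  have T: "linear_map K (family_sum I (ob D)) W ?T"
    by (rule linear_map_family_copair[OF field W \<phi>])
  have T_inj: "?T (family_inj I (ob D) k y) = \<phi> k y" if "k \<in> I" "y \<in> carrier (ob D k)" for k y
    by (rule family_copair_inj[where V = "ob D" and \<phi> = \<phi>, OF W \<phi>[OF that(1)] that])
  have "subspace K {f \<in> carrier (family_sum I (ob D)). ?T f = \<zero>\<^bsub>W\<^esub>} (family_sum I (ob D))"
    by (rule subspace_kernel[OF T])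
  moreover have "{family_inj I (ob D) i x \<ominus>\<^bsub>family_sum I (ob D)\<^esub> family_inj I (ob D) j (arr D i j x)
      | i j x. i \<in> I \<and> j \<in> I \<and> R i j \<and> x \<in> carrier (ob D i)}
      \<subseteq> {f \<in> carrier (family_sum I (ob D)). ?T f = \<zero>\<^bsub>W\<^esub>}"
  proof clarify
    fix i j x assume ij: "i \<in> I" "j \<in> I" "R i j" and x: "x \<in> carrier (ob D i)"
    have y: "arr D i j x \<in> carrier (ob D j)"
      by (rule linear_map_closed[OF functor_arr[OF diagram ij] x])
    show "family_inj I (ob D) i x \<ominus>\<^bsub>family_sum I (ob D)\<^esub> family_inj I (ob D) j (arr D i j x)
        \<in> carrier (family_sum I (ob D)) \<and>
      ?T (family_inj I (ob D) i x \<ominus>\<^bsub>family_sum I (ob D)\<^esub> family_inj I (ob D) j (arr D i j x)) = \<zero>\<^bsub>W\<^esub>"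
      using family_inj_closed[OF ij(1) x] family_inj_closed[OF ij(2) y] linear_map_closed[OF \<phi>[OF ij(1)] x]
      by (simp add: linear_map_minus[OF T] T_inj ij x y cocone)
  qed
  ultimately have "colim_relations K I R D \<subseteq> {f \<in> carrier (family_sum I (ob D)). ?T f = \<zero>\<^bsub>W\<^esub>}"
    unfolding colim_relations_def by (intro S.span_is_subset) (simp_all add: subspace_def)
  then have const: "?T ` (colim_relations K I R D +>\<^bsub>family_sum I (ob D)\<^esub> f) = {?T f}"
    if "f \<in> carrier (family_sum I (ob D))" for f
    using that by (intro linear_image_coset[OF subspace_colim_relations T]) auto
  have desc: "colim_desc I D W \<phi> (colim_relations K I R D +>\<^bsub>family_sum I (ob D)\<^esub> f) = ?T f"
    if "f \<in> carrier (family_sum I (ob D))" for f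
    using const[OF that] by (simp add: colim_desc_def family_copair_def[abs_def])
  show "linear_map K (colim K I R D) W (colim_desc I D W \<phi>)"
    unfolding colim_def by (rule linear_map_from_quotient[OF subspace_colim_relations T desc])
  show "colim_desc I D W \<phi> (colim_inj K I R D i x) = \<phi> i x" if "i \<in> I" "x \<in> carrier (ob D i)"
    unfolding colim_inj_def using that by (simp add: desc family_inj_closed T_inj)
qed

lemma subspace_limit: "subspace K (carrier (limit I R D)) (family_prod I (ob D))"
proof -
  interpret P: vectorspace K "family_prod I (ob D)"
    by (rule vectorspace_family_prod[OF field functor_ob[OF diagram]])
  note E = linear_map_eval[where V = "ob D" and I = I, OF field functor_ob[OF diagram]]
  have eval: "(f \<oplus>\<^bsub>family_prod I (ob D)\<^esub> g) i = f i \<oplus>\<^bsub>ob D i\<^esub> g i"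
    "(c \<odot>\<^bsub>family_prod I (ob D)\<^esub> f) i = c \<odot>\<^bsub>ob D i\<^esub> f i"
    "\<zero>\<^bsub>family_prod I (ob D)\<^esub> i = \<zero>\<^bsub>ob D i\<^esub>" if "i \<in> I" for f g c i
    using that by (simp_all add: family_prod_def)
  have mem: "f i \<in> carrier (ob D i)" if "f \<in> carrier (limit I R D)" "i \<in> I" for f i
    using that by (simp add: limit_def family_prod_def PiE_iff)
  show ?thesis
  proof (rule subspaceI[OF P.vectorspace_axioms])
    show "carrier (limit I R D) \<subseteq> carrier (family_prod I (ob D))" by (auto simp: limit_def)
    show "\<zero>\<^bsub>family_prod I (ob D)\<^esub> \<in> carrier (limit I R D)"
      by (simp add: limit_def eval linear_map_zero[OF functor_arr[OF diagram]])
  next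
    fix f g assume f: "f \<in> carrier (limit I R D)" and g: "g \<in> carrier (limit I R D)"
    show "f \<oplus>\<^bsub>family_prod I (ob D)\<^esub> g \<in> carrier (limit I R D)"
      using f g mem[OF f] mem[OF g]
      by (simp add: limit_def eval linear_map_add[OF functor_arr[OF diagram]])
  next
    fix c f assume c: "c \<in> carrier K" and f: "f \<in> carrier (limit I R D)"
    show "c \<odot>\<^bsub>family_prod I (ob D)\<^esub> f \<in> carrier (limit I R D)"
      using c f mem[OF f]
      by (simp add: limit_def eval linear_map_smult[OF functor_arr[OF diagram]])
  qed
qed

lemma vectorspace_limit: "vectorspace K (limit I R D)"
  using vectorspace_subspace[OF subspace_limit] by (simp add: limit_def)

lemma linear_map_into_limit:
  assumes U: "vectorspace K U"
    and \<phi>: "\<And>i. i \<in> I \<Longrightarrow> linear_map K U (ob D i) (\<phi> i)"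
    and cone: "\<And>i j x. \<lbrakk>i \<in> I; j \<in> I; R i j; x \<in> carrier U\<rbrakk> \<Longrightarrow> arr D i j (\<phi> i x) = \<phi> j x"
  shows "linear_map K U (limit I R D) (\<lambda>x. \<lambda>i\<in>I. \<phi> i x)"
proof -
  have L: "linear_map K U (family_prod I (ob D)) (\<lambda>x. \<lambda>i\<in>I. \<phi> i x)"
    by (rule linear_map_into_family_prod[OF field U \<phi>])
  have "(\<lambda>i\<in>I. \<phi> i x) \<in> carrier (limit I R D)" if "x \<in> carrier U" for x
    using linear_map_closed[OF L that] cone that by (simp add: limit_def)
  from linear_map_into_subspace[OF L subspace_limit this]
  show ?thesis by (simp add: limit_def)
qed

lemma linear_map_limit_eval:
  assumes "i \<in> I"
  shows "linear_map K (limit I R D) (ob D i) (\<lambda>f. f i)"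
  using linear_map_on_subspace[OF linear_map_eval[where V = "ob D" and I = I,
        OF field functor_ob[OF diagram] assms] subspace_limit]
  by (simp add: limit_def)

lemma limit_arr:
  "\<lbrakk>f \<in> carrier (limit I R D); i \<in> I; j \<in> I; R i j\<rbrakk> \<Longrightarrow> arr D i j (f i) = f j"
  by (simp add: limit_def)

lemma limit_extensional: "f \<in> carrier (limit I R D) \<Longrightarrow> f \<in> extensional I"
  by (simp add: limit_def family_prod_def PiE_iff)

end


section \<open>Kan extensions along a full inclusion of preorders\<close>

text \<open>
  The functor \<open>G\<close> is given on all of \<open>Q\<close>, while the extensions only see its restriction to the sampled
  part \<open>I\<close>. Having \<open>G\<close> on all of \<open>Q\<close> provides the comparison maps \<open>Lan \<rightarrow> G \<rightarrow> Ran\<close>.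
\<close>

locale kan_extension =
  fixes K :: "('k, 'm) ring_scheme" and Q I :: "'i set" and R :: "'i \<Rightarrow> 'i \<Rightarrow> bool"
    and G :: "('i, 'k, 'v) diagram"
  assumes field: "field K" and G: "vect_functor K Q R G" and I: "I \<subseteq> Q"
    and refl: "p \<in> Q \<Longrightarrow> R p p"
    and trans: "\<lbrakk>p \<in> Q; q \<in> Q; r \<in> Q; R p q; R q r\<rbrakk> \<Longrightarrow> R p r"
begin

abbreviation below :: "'i \<Rightarrow> 'i set" where "below q \<equiv> {p \<in> I. R p q}"
abbreviation above :: "'i \<Rightarrow> 'i set" where "above q \<equiv> {p \<in> I. R q p}"

lemma below: "vect_diagram K (below q) R G"
  using functor_subset[OF G, of "below q"] I by (auto intro!: vect_diagram.intro field)

lemma above: "vect_diagram K (above q) R G"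
  using functor_subset[OF G, of "above q"] I by (auto intro!: vect_diagram.intro field)

lemma below_mono: "\<lbrakk>p \<in> below q; q \<in> Q; r \<in> Q; R q r\<rbrakk> \<Longrightarrow> p \<in> below r"
  using trans I by blast

lemma above_mono: "\<lbrakk>p \<in> above r; q \<in> Q; r \<in> Q; R q r\<rbrakk> \<Longrightarrow> p \<in> above q"
  using trans I by blast

lemma G_arr: "\<lbrakk>p \<in> Q; q \<in> Q; R p q\<rbrakk> \<Longrightarrow> linear_map K (ob G p) (ob G q) (arr G p q)"
  by (rule functor_arr[OF G])

lemma G_closed: "\<lbrakk>p \<in> Q; q \<in> Q; R p q; x \<in> carrier (ob G p)\<rbrakk> \<Longrightarrow> arr G p q x \<in> carrier (ob G q)"
  by (rule linear_map_closed[OF G_arr])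

abbreviation coproj :: "'i \<Rightarrow> 'i \<Rightarrow> 'v \<Rightarrow> ('i \<Rightarrow> 'v) set" where
  "coproj q \<equiv> colim_inj K (below q) R G"

lemma lan_ob: "ob (lan K I R G) q = colim K (below q) R G"
  by (simp add: lan_def)

lemma lan_maps_eq:
  assumes "linear_map K (ob (lan K I R G) q) W S" "linear_map K (ob (lan K I R G) q) W T"
    and "\<And>p x. \<lbrakk>p \<in> below q; x \<in> carrier (ob G p)\<rbrakk> \<Longrightarrow> S (coproj q p x) = T (coproj q p x)"
    and "c \<in> carrier (ob (lan K I R G) q)"
  shows "S c = T c"
  using vect_diagram.colim_maps_eq[OF below, of q W S T c] assms unfolding lan_ob by blast

lemma linear_map_coproj:
  "p \<in> below q \<Longrightarrow> linear_map K (ob G p) (ob (lan K I R G) q) (coproj q p)"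
  unfolding lan_ob by (rule vect_diagram.linear_map_colim_inj[OF below])

lemma coproj_arr:
  "\<lbrakk>p \<in> below q; p' \<in> below q; R p p'; x \<in> carrier (ob G p)\<rbrakk>
    \<Longrightarrow> coproj q p' (arr G p p' x) = coproj q p x"
  by (rule vect_diagram.colim_inj_arr[OF below])

lemma
  assumes q: "q \<in> Q" and r: "r \<in> Q" and R: "R q r"
  shows linear_map_lan_arr:
      "linear_map K (ob (lan K I R G) q) (ob (lan K I R G) r) (arr (lan K I R G) q r)"
    and lan_arr_coproj: "\<lbrakk>p \<in> below q; x \<in> carrier (ob G p)\<rbrakk>
      \<Longrightarrow> arr (lan K I R G) q r (coproj q p x) = coproj r p x"
proof -
  have V: "vectorspace K (colim K (below r) R G)" by (rule vect_diagram.vectorspace_colim[OF below])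
  have L: "linear_map K (ob G p) (colim K (below r) R G) (coproj r p)" if "p \<in> below q" for p
    using linear_map_coproj[OF below_mono[OF that q r R]] by (simp add: lan_ob)
  have C: "coproj r p' (arr G p p' x) = coproj r p x"
    if "p \<in> below q" "p' \<in> below q" "R p p'" "x \<in> carrier (ob G p)" for p p' x
    using coproj_arr[OF below_mono[OF that(1) q r R] below_mono[OF that(2) q r R] that(3,4)] .
  show "linear_map K (ob (lan K I R G) q) (ob (lan K I R G) r) (arr (lan K I R G) q r)"
    using vect_diagram.linear_map_colim_desc[OF below V L C] by (simp add: lan_def)
  show "arr (lan K I R G) q r (coproj q p x) = coproj r p x"
    if "p \<in> below q" "x \<in> carrier (ob G p)"
    using vect_diagram.colim_desc_inj[OF below V L C that] by (simp add: lan_def)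
qed

lemma lan_functor: "vect_functor K Q R (lan K I R G)"
proof (rule vect_functorI)
  show "vectorspace K (ob (lan K I R G) q)" if "q \<in> Q" for q
    unfolding lan_ob by (rule vect_diagram.vectorspace_colim[OF below])
  note V = this
  show "linear_map K (ob (lan K I R G) q) (ob (lan K I R G) r) (arr (lan K I R G) q r)"
    if "q \<in> Q" "r \<in> Q" "R q r" for q r
    using that by (rule linear_map_lan_arr)
  note L = this
  show "arr (lan K I R G) q q c = c" if q: "q \<in> Q" and c: "c \<in> carrier (ob (lan K I R G) q)" for q c
    by (rule lan_maps_eq[OF L[OF q q refl[OF q]] _ _ c])
      (simp_all add: linear_mapI V q lan_arr_coproj[OF q q refl[OF q]])
  show "arr (lan K I R G) q r (arr (lan K I R G) p q c) = arr (lan K I R G) p r c"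
    if pqr: "p \<in> Q" "q \<in> Q" "r \<in> Q" "R p q" "R q r" and c: "c \<in> carrier (ob (lan K I R G) p)"
    for p q r c
  proof -
    have pr: "R p r" using trans pqr by blast
    show ?thesis
    proof (rule lan_maps_eq[OF linear_map_comp[OF L[OF pqr(1,2,4)] L[OF pqr(2,3,5)]]
          L[OF pqr(1,3) pr] _ c])
      fix p' x assume p': "p' \<in> below p" and x: "x \<in> carrier (ob G p')"
      show "arr (lan K I R G) q r (arr (lan K I R G) p q (coproj p p' x)) =
          arr (lan K I R G) p r (coproj p p' x)"
        using lan_arr_coproj[OF pqr(1,2,4) p' x] lan_arr_coproj[OF pqr(1,3) pr p' x]
          lan_arr_coproj[OF pqr(2,3,5) below_mono[OF p' pqr(1,2,4)] x]
        by simp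
    qed
  qed
qed

lemma ran_ob: "ob (ran I R G) q = limit (above q) R G"
  by (simp add: ran_def)

lemma ran_arr: "arr (ran I R G) q r f = restrict f (above r)"
  by (simp add: ran_def)

lemma linear_map_ran_eval:
  "p \<in> above q \<Longrightarrow> linear_map K (ob (ran I R G) q) (ob G p) (\<lambda>f. f p)"
  unfolding ran_ob by (rule vect_diagram.linear_map_limit_eval[OF above])

lemma ran_compatible:
  "\<lbrakk>f \<in> carrier (ob (ran I R G) q); p \<in> above q; p' \<in> above q; R p p'\<rbrakk> \<Longrightarrow> arr G p p' (f p) = f p'"
  unfolding ran_ob by (rule vect_diagram.limit_arr[OF above])

lemma ran_extensional: "f \<in> carrier (ob (ran I R G) q) \<Longrightarrow> f \<in> extensional (above q)"
  unfolding ran_ob by (rule vect_diagram.limit_extensional[OF above])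

lemma linear_map_into_ran:
  assumes "vectorspace K U" "\<And>p. p \<in> above q \<Longrightarrow> linear_map K U (ob G p) (\<phi> p)"
    and "\<And>p p' x. \<lbrakk>p \<in> above q; p' \<in> above q; R p p'; x \<in> carrier U\<rbrakk>
      \<Longrightarrow> arr G p p' (\<phi> p x) = \<phi> p' x"
  shows "linear_map K U (ob (ran I R G) q) (\<lambda>x. \<lambda>p\<in>above q. \<phi> p x)"
  unfolding ran_ob by (rule vect_diagram.linear_map_into_limit[OF above assms])

lemma vectorspace_ran: "vectorspace K (ob (ran I R G) q)"
  unfolding ran_ob by (rule vect_diagram.vectorspace_limit[OF above])

lemma linear_map_ran_arr:
  assumes "q \<in> Q" "r \<in> Q" "R q r"
  shows "linear_map K (ob (ran I R G) q) (ob (ran I R G) r) (arr (ran I R G) q r)"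
proof -
  have "linear_map K (ob (ran I R G) q) (ob (ran I R G) r) (\<lambda>f. \<lambda>p\<in>above r. f p)"
    by (rule linear_map_into_ran)
      (use above_mono[OF _ assms] in \<open>auto intro: vectorspace_ran linear_map_ran_eval ran_compatible\<close>)
  then show ?thesis by (rule linear_map_cong) (simp add: ran_arr)
qed

lemma ran_functor: "vect_functor K Q R (ran I R G)"
proof (rule vect_functorI)
  fix q r assume "q \<in> Q" "r \<in> Q" "R q r"
  then show "linear_map K (ob (ran I R G) q) (ob (ran I R G) r) (arr (ran I R G) q r)"
    by (rule linear_map_ran_arr)
next
  fix q f assume "f \<in> carrier (ob (ran I R G) q)"
  then show "arr (ran I R G) q q f = f"
    unfolding ran_arr by (intro extensional_restrict ran_extensional)
next
  fix p q r f assume "p \<in> Q" "q \<in> Q" "r \<in> Q" "R p q" "R q r"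
  then show "arr (ran I R G) q r (arr (ran I R G) p q f) = arr (ran I R G) p r f"
    using above_mono[of _ r q] by (auto simp: ran_arr restrict_def fun_eq_iff)
qed (rule vectorspace_ran)

text \<open>
  The counit of the adjunction between left extension and restriction, and the unit of the one between
  restriction and right extension.
\<close>

definition counit :: "'i \<Rightarrow> ('i \<Rightarrow> 'v) set \<Rightarrow> 'v" where
  "counit q = colim_desc (below q) G (ob G q) (\<lambda>p. arr G p q)"

definition unit :: "'i \<Rightarrow> 'v \<Rightarrow> 'i \<Rightarrow> 'v" where
  "unit q x = (\<lambda>p \<in> above q. arr G q p x)"

lemma
  assumes q: "q \<in> Q"
  shows linear_map_counit: "linear_map K (ob (lan K I R G) q) (ob G q) (counit q)"
    and counit_coproj: "\<lbrakk>p \<in> below q; x \<in> carrier (ob G p)\<rbrakk> \<Longrightarrow> counit q (coproj q p x) = arr G p q x"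
proof -
  have V: "vectorspace K (ob G q)" by (rule functor_ob[OF G q])
  have L: "linear_map K (ob G p) (ob G q) (arr G p q)" if "p \<in> below q" for p
    using that I q by (intro G_arr) auto
  have C: "arr G p' q (arr G p p' x) = arr G p q x"
    if "p \<in> below q" "p' \<in> below q" "R p p'" "x \<in> carrier (ob G p)" for p p' x
    using that I q by (intro functor_comp[OF G]) auto
  show "linear_map K (ob (lan K I R G) q) (ob G q) (counit q)"
    unfolding counit_def lan_ob by (rule vect_diagram.linear_map_colim_desc[OF below V L C])
  show "counit q (coproj q p x) = arr G p q x" if "p \<in> below q" "x \<in> carrier (ob G p)"
    unfolding counit_def by (rule vect_diagram.colim_desc_inj[OF below V L C that])
qed

lemma linear_map_unit:
  assumes q: "q \<in> Q"
  shows "linear_map K (ob G q) (ob (ran I R G) q) (unit q)"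
  unfolding unit_def
proof (rule linear_map_into_ran)
  show "vectorspace K (ob G q)" by (rule functor_ob[OF G q])
  show "linear_map K (ob G q) (ob G p) (arr G q p)" if "p \<in> above q" for p
    using that I q by (intro G_arr) auto
  show "arr G p p' (arr G q p x) = arr G q p' x"
    if "p \<in> above q" "p' \<in> above q" "R p p'" "x \<in> carrier (ob G q)" for p p' x
    using that I q by (intro functor_comp[OF G]) auto
qed

lemma unit_arr:
  assumes "q \<in> Q" "r \<in> Q" "R q r" "x \<in> carrier (ob G q)"
  shows "arr (ran I R G) q r (unit q x) = unit r (arr G q r x)"
proof -
  have "arr G r p (arr G q r x) = arr G q p x" if "p \<in> above r" for p
    using functor_comp[OF G, of q r p x] assms I that by auto
  then show ?thesis
    using above_mono[of _ r q] assms by (auto simp: unit_def ran_arr restrict_def fun_eq_iff)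
qed

lemma counit_arr:
  assumes qr: "q \<in> Q" "r \<in> Q" "R q r" and c: "c \<in> carrier (ob (lan K I R G) q)"
  shows "counit r (arr (lan K I R G) q r c) = arr G q r (counit q c)"
proof (rule lan_maps_eq[OF linear_map_comp[OF linear_map_lan_arr[OF qr] linear_map_counit[OF qr(2)]]
      linear_map_comp[OF linear_map_counit[OF qr(1)] G_arr[OF qr]] _ c])
  fix p x assume p: "p \<in> below q" and x: "x \<in> carrier (ob G p)"
  have "arr G q r (arr G p q x) = arr G p r x"
    using functor_comp[OF G, of p q r x] qr I p x by auto
  then show "counit r (arr (lan K I R G) q r (coproj q p x)) = arr G q r (counit q (coproj q p x))"
    using p x qr below_mono[OF p qr] by (simp add: lan_arr_coproj counit_coproj)
qed

lemma
  assumes q: "q \<in> Q"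
  shows linear_map_lan_to_ran:
      "linear_map K (ob (lan K I R G) q) (ob (ran I R G) q) (lan_to_ran I R G q)"
    and lan_to_ran_eq: "c \<in> carrier (ob (lan K I R G) q) \<Longrightarrow> lan_to_ran I R G q c = unit q (counit q c)"
proof -
  let ?\<phi> = "\<lambda>p x. \<lambda>p'\<in>above q. arr G p p' x"
  have \<phi>: "?\<phi> p x = unit q (arr G p q x)" if "p \<in> below q" "x \<in> carrier (ob G p)" for p x
    using that q I by (auto simp: unit_def fun_eq_iff restrict_def intro!: functor_comp[OF G, symmetric])
  have L: "linear_map K (ob G p) (ob (ran I R G) q) (?\<phi> p)" if "p \<in> below q" for p
    by (rule linear_map_cong[OF linear_map_comp[OF G_arr linear_map_unit[OF q]] \<phi>])
      (use that q I in auto)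
  have C: "?\<phi> p' (arr G p p' x) = ?\<phi> p x"
    if "p \<in> below q" "p' \<in> below q" "R p p'" "x \<in> carrier (ob G p)" for p p' x
    using that G_closed[of p p' x] functor_comp[OF G, of p p' q x] I q by (simp add: \<phi> subset_iff)
  show lin: "linear_map K (ob (lan K I R G) q) (ob (ran I R G) q) (lan_to_ran I R G q)"
    unfolding lan_to_ran_def lan_ob
    by (rule vect_diagram.linear_map_colim_desc[OF below vectorspace_ran L C])
  have inj: "lan_to_ran I R G q (coproj q p x) = ?\<phi> p x"
    if "p \<in> below q" "x \<in> carrier (ob G p)" for p x
    unfolding lan_to_ran_def
    by (rule vect_diagram.colim_desc_inj[OF below vectorspace_ran L C that])
  show "lan_to_ran I R G q c = unit q (counit q c)" if c: "c \<in> carrier (ob (lan K I R G) q)"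
    by (rule lan_maps_eq[OF lin linear_map_comp[OF linear_map_counit linear_map_unit] _ c])
      (simp_all add: q inj \<phi> counit_coproj del: restrict_apply)
qed

lemma cen_ob:
  "ob (cen K I R G) q =
    (ob (ran I R G) q)\<lparr>carrier := lan_to_ran I R G q ` carrier (ob (lan K I R G) q)\<rparr>"
  by (simp add: cen_def)

lemma cen_arr: "arr (cen K I R G) = arr (ran I R G)"
  by (simp add: cen_def)

lemma subspace_cen: "q \<in> Q \<Longrightarrow> subspace K (carrier (ob (cen K I R G) q)) (ob (ran I R G) q)"
  using subspace_image[OF linear_map_lan_to_ran] by (simp add: cen_ob)

lemma cen_subset: "q \<in> Q \<Longrightarrow> f \<in> carrier (ob (cen K I R G) q) \<Longrightarrow> f \<in> carrier (ob (ran I R G) q)"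
  using subspace_subset[OF subspace_cen] by blast

lemma linear_map_into_cen:
  assumes T: "linear_map K U (ob (ran I R G) q) T" and q: "q \<in> Q"
    and "\<And>x. x \<in> carrier U \<Longrightarrow> T x \<in> carrier (ob (cen K I R G) q)"
  shows "linear_map K U (ob (cen K I R G) q) T"
  using linear_map_into_subspace[OF T subspace_cen[OF q] assms(3)] by (simp add: cen_ob)

lemma linear_map_on_cen:
  assumes T: "linear_map K (ob (ran I R G) q) U T" and q: "q \<in> Q"
  shows "linear_map K (ob (cen K I R G) q) U T"
  using linear_map_on_subspace[OF T subspace_cen[OF q]] by (simp add: cen_ob)

text \<open>The image of the natural transformation \<open>Lan \<rightarrow> Ran\<close> is stable under the maps of \<open>Ran\<close>.\<close>

lemma cen_arr_closed:
  assumes qr: "q \<in> Q" "r \<in> Q" "R q r" and f: "f \<in> carrier (ob (cen K I R G) q)"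
  shows "arr (ran I R G) q r f \<in> carrier (ob (cen K I R G) r)"
proof -
  obtain c where c: "c \<in> carrier (ob (lan K I R G) q)" and f: "f = lan_to_ran I R G q c"
    using f by (auto simp: cen_ob)
  have c': "arr (lan K I R G) q r c \<in> carrier (ob (lan K I R G) r)"
    by (rule linear_map_closed[OF linear_map_lan_arr[OF qr] c])
  have "arr (ran I R G) q r f = lan_to_ran I R G r (arr (lan K I R G) q r c)"
    using linear_map_closed[OF linear_map_counit c] qr c c'
    by (simp add: f lan_to_ran_eq unit_arr counit_arr)
  then show ?thesis using c' by (simp add: cen_ob)
qed

lemma cen_functor: "vect_functor K Q R (cen K I R G)"
proof (rule vect_functorI)
  fix q assume "q \<in> Q"
  then show "vectorspace K (ob (cen K I R G) q)"
    using vectorspace_subspace[OF subspace_cen] by (simp add: cen_ob)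
next
  fix q r assume "q \<in> Q" "r \<in> Q" "R q r"
  then show "linear_map K (ob (cen K I R G) q) (ob (cen K I R G) r) (arr (cen K I R G) q r)"
    unfolding cen_arr
    by (intro linear_map_into_cen linear_map_on_cen linear_map_ran_arr cen_arr_closed)
qed (auto simp: cen_arr cen_subset functor_id[OF ran_functor] functor_comp[OF ran_functor])

end


section \<open>Interleaving along a monotone curve\<close>

text \<open>
  A monotone curve \<open>\<gamma>\<close> in \<open>Q\<close> for which each step from \<open>\<gamma> x\<close> to \<open>\<gamma> (x + \<epsilon>)\<close> passes through a sampled point
  \<open>\<mu> x\<close>, where \<open>x + \<epsilon>\<close> is truncated at \<open>Sup X\<close>. The restriction of \<open>G\<close> to the curve is then \<open>\<epsilon>\<close>-interleaved with that of each Kan extension.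
\<close>

locale interpolated_curve = kan_extension K Q I R G
  for K :: "('k, 'm) ring_scheme" and Q I :: "'i set" and R :: "'i \<Rightarrow> 'i \<Rightarrow> bool"
    and G :: "('i, 'k, 'v) diagram" +
  fixes X :: "real set" and \<epsilon> :: real and \<gamma> \<mu> :: "real \<Rightarrow> 'i"
  assumes \<epsilon>: "0 \<le> \<epsilon>"
    and shift_closed: "x \<in> X \<Longrightarrow> shift X \<epsilon> x \<in> X"
    and shift_shift: "x \<in> X \<Longrightarrow> shift X \<epsilon> (shift X \<epsilon> x) = shift X (2 * \<epsilon>) x"
    and curve: "x \<in> X \<Longrightarrow> \<gamma> x \<in> Q"
    and curve_mono: "\<lbrakk>x \<in> X; y \<in> X; x \<le> y\<rbrakk> \<Longrightarrow> R (\<gamma> x) (\<gamma> y)"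
    and mid: "x \<in> X \<Longrightarrow> \<mu> x \<in> I"
    and mid_mono: "\<lbrakk>x \<in> X; y \<in> X; x \<le> y\<rbrakk> \<Longrightarrow> R (\<mu> x) (\<mu> y)"
    and curve_mid: "x \<in> X \<Longrightarrow> R (\<gamma> x) (\<mu> x)"
    and mid_curve: "x \<in> X \<Longrightarrow> R (\<mu> x) (\<gamma> (shift X \<epsilon> x))"
begin

lemma precompose_functor:
  assumes F: "vect_functor K Q R F"
  shows "vect_functor K X (\<le>) (precompose F \<gamma>)"
  by (rule vect_functorI)
    (simp_all add: precompose_def curve curve_mono functor_ob[OF F] functor_arr[OF F]
      functor_id[OF F] functor_comp[OF F])

lemma shift_mono: "x \<le> y \<Longrightarrow> shift X \<epsilon> x \<le> shift X \<epsilon> y"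
  by (auto simp: shift_def)

lemma midQ: "x \<in> X \<Longrightarrow> \<mu> x \<in> Q"
  using mid I by auto

lemma mid_below: "x \<in> X \<Longrightarrow> \<mu> x \<in> below (\<gamma> (shift X \<epsilon> x))"
  using mid mid_curve by auto

lemma mid_above: "x \<in> X \<Longrightarrow> \<mu> x \<in> above (\<gamma> x)"
  using mid curve_mid by auto

lemma curve_shift: "x \<in> X \<Longrightarrow> R (\<gamma> x) (\<gamma> (shift X \<epsilon> x))"
  using trans[OF curve midQ curve] curve_mid mid_curve shift_closed by blast

lemma G_square:
  assumes "p \<in> Q" "q \<in> Q" "q' \<in> Q" "r \<in> Q" "R p q" "R q r" "R p q'" "R q' r" "u \<in> carrier (ob G p)"
  shows "arr G q r (arr G p q u) = arr G q' r (arr G p q' u)"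
  using assms by (simp add: functor_comp[OF G])

text \<open>
  The composites are compared on coprojections. The essential step is that the coprojection from an
  element \<open>p \<le> \<gamma> x\<close> of \<open>I\<close> factors through the one from the sampled point \<open>\<mu> (x + \<epsilon>)\<close>.
\<close>

lemma lan_interleaving:
  "interleaving K X \<epsilon> (precompose G \<gamma>) (precompose (lan K I R G) \<gamma>)
    (\<lambda>x u. coproj (\<gamma> (shift X \<epsilon> x)) (\<mu> x) (arr G (\<gamma> x) (\<mu> x) u))
    (\<lambda>x c. arr G (\<gamma> x) (\<gamma> (shift X \<epsilon> x)) (counit (\<gamma> x) c))"
  (is "interleaving _ _ _ ?U ?V ?\<Phi> ?\<Psi>")
proof -
  let ?T = "shift X \<epsilon>" and ?L = "lan K I R G"
  note Q = curve midQ shift_closed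
  have lin\<Phi>: "linear_map K (ob G (\<gamma> x)) (ob ?L (\<gamma> (?T x))) (?\<Phi> x)" if x: "x \<in> X" for x
    by (rule linear_map_comp[OF G_arr linear_map_coproj[OF mid_below]])
      (simp_all add: x Q curve_mid)
  have lin\<Psi>: "linear_map K (ob ?L (\<gamma> x)) (ob G (\<gamma> (?T x))) (?\<Psi> x)" if x: "x \<in> X" for x
    by (rule linear_map_comp[OF linear_map_counit G_arr]) (simp_all add: x Q curve_shift)
  have nat\<Phi>: "?\<Phi> y (arr G (\<gamma> x) (\<gamma> y) u) = arr ?L (\<gamma> (?T x)) (\<gamma> (?T y)) (?\<Phi> x u)"
    if x: "x \<in> X" and y: "y \<in> X" and xy: "x \<le> y" and u: "u \<in> carrier (ob G (\<gamma> x))" for x y u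
  proof -
    have v: "arr G (\<gamma> x) (\<mu> x) u \<in> carrier (ob G (\<mu> x))"
      by (rule G_closed) (simp_all add: x u Q curve_mid)
    have R: "R (\<gamma> (?T x)) (\<gamma> (?T y))" by (simp add: curve_mono shift_closed shift_mono x y xy)
    have mx: "\<mu> x \<in> below (\<gamma> (?T y))"
      using below_mono[OF mid_below[OF x] _ _ R] Q x y by simp
    have "arr G (\<gamma> y) (\<mu> y) (arr G (\<gamma> x) (\<gamma> y) u) = arr G (\<mu> x) (\<mu> y) (arr G (\<gamma> x) (\<mu> x) u)"
      by (rule G_square) (simp_all add: x y u Q curve_mono xy curve_mid mid_mono)
    then have "?\<Phi> y (arr G (\<gamma> x) (\<gamma> y) u) =
        coproj (\<gamma> (?T y)) (\<mu> y) (arr G (\<mu> x) (\<mu> y) (arr G (\<gamma> x) (\<mu> x) u))" by simp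
    also have "\<dots> = coproj (\<gamma> (?T y)) (\<mu> x) (arr G (\<gamma> x) (\<mu> x) u)"
      by (rule coproj_arr[OF mx mid_below[OF y] mid_mono[OF x y xy] v])
    also have "\<dots> = arr ?L (\<gamma> (?T x)) (\<gamma> (?T y)) (?\<Phi> x u)"
      using lan_arr_coproj[OF _ _ R mid_below[OF x] v] Q x y by simp
    finally show ?thesis .
  qed
  have nat\<Psi>: "?\<Psi> y (arr ?L (\<gamma> x) (\<gamma> y) c) = arr G (\<gamma> (?T x)) (\<gamma> (?T y)) (?\<Psi> x c)"
    if x: "x \<in> X" and y: "y \<in> X" and xy: "x \<le> y" and c: "c \<in> carrier (ob ?L (\<gamma> x))" for x y c
  proof -
    have k: "counit (\<gamma> x) c \<in> carrier (ob G (\<gamma> x))"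
      by (rule linear_map_closed[OF linear_map_counit[OF curve[OF x]] c])
    have "?\<Psi> y (arr ?L (\<gamma> x) (\<gamma> y) c) =
        arr G (\<gamma> y) (\<gamma> (?T y)) (arr G (\<gamma> x) (\<gamma> y) (counit (\<gamma> x) c))"
      by (simp add: counit_arr[OF curve[OF x] curve[OF y] curve_mono[OF x y xy] c])
    also have "\<dots> = arr G (\<gamma> (?T x)) (\<gamma> (?T y)) (?\<Psi> x c)"
      by (rule G_square) (simp_all add: x y k Q curve_mono xy curve_shift shift_mono)
    finally show ?thesis .
  qed
  have \<Psi>\<Phi>: "?\<Psi> (?T x) (?\<Phi> x u) = arr G (\<gamma> x) (\<gamma> (shift X (2 * \<epsilon>) x)) u"
    if x: "x \<in> X" and u: "u \<in> carrier (ob G (\<gamma> x))" for x u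
  proof -
    have v: "arr G (\<gamma> x) (\<mu> x) u \<in> carrier (ob G (\<mu> x))"
      by (rule G_closed) (simp_all add: x u Q curve_mid)
    have "counit (\<gamma> (?T x)) (?\<Phi> x u) = arr G (\<mu> x) (\<gamma> (?T x)) (arr G (\<gamma> x) (\<mu> x) u)"
      by (rule counit_coproj[OF _ mid_below[OF x] v]) (simp add: x Q)
    also have "\<dots> = arr G (\<gamma> x) (\<gamma> (?T x)) u"
      by (rule functor_comp[OF G]) (simp_all add: x u Q curve_mid mid_curve)
    finally have "?\<Psi> (?T x) (?\<Phi> x u) =
        arr G (\<gamma> (?T x)) (\<gamma> (?T (?T x))) (arr G (\<gamma> x) (\<gamma> (?T x)) u)" by simp
    also have "\<dots> = arr G (\<gamma> x) (\<gamma> (?T (?T x))) u"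
      by (rule functor_comp[OF G]) (simp_all add: x u Q curve_shift)
    finally show ?thesis by (simp add: shift_shift x)
  qed
  have \<Phi>\<Psi>: "?\<Phi> (?T x) (?\<Psi> x c) = arr ?L (\<gamma> x) (\<gamma> (shift X (2 * \<epsilon>) x)) c"
    if x: "x \<in> X" and c: "c \<in> carrier (ob ?L (\<gamma> x))" for x c
  proof -
    have Tx: "?T x \<in> X" and TTx: "?T (?T x) \<in> X" using x by (simp_all add: shift_closed)
    have R: "R (\<gamma> x) (\<gamma> (?T (?T x)))"
      using trans[OF _ _ _ curve_shift[OF x] curve_shift[OF Tx]] curve x Tx TTx by blast
    have "?\<Phi> (?T x) (?\<Psi> x c) = arr ?L (\<gamma> x) (\<gamma> (?T (?T x))) c"
    proof (rule lan_maps_eq[OF linear_map_comp[OF lin\<Psi>[OF x] lin\<Phi>[OF Tx]]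
          linear_map_lan_arr[OF curve[OF x] curve[OF TTx] R] _ c])
      fix p u assume p: "p \<in> below (\<gamma> x)" and u: "u \<in> carrier (ob G p)"
      have pQ: "p \<in> Q" using p I by auto
      have pTx: "p \<in> below (\<gamma> (?T x))"
        by (rule below_mono[OF p curve[OF x] curve[OF Tx] curve_shift[OF x]])
      have Rp: "R p (\<mu> (?T x))"
        using trans[OF pQ curve[OF Tx] midQ[OF Tx] _ curve_mid[OF Tx]] pTx by simp
      have v: "arr G p (\<gamma> (?T x)) u \<in> carrier (ob G (\<gamma> (?T x)))"
        using pTx by (intro G_closed pQ curve Tx u) auto
      have pTTx: "p \<in> below (\<gamma> (?T (?T x)))"
        by (rule below_mono[OF pTx curve[OF Tx] curve[OF TTx] curve_shift[OF Tx]])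
      have "?\<Psi> x (coproj (\<gamma> x) p u) = arr G p (\<gamma> (?T x)) u"
        using functor_comp[OF G pQ curve[OF x] curve[OF Tx] _ curve_shift[OF x] u] p
        by (simp add: counit_coproj[OF curve[OF x] p u])
      then have "?\<Phi> (?T x) (?\<Psi> x (coproj (\<gamma> x) p u)) =
          coproj (\<gamma> (?T (?T x))) (\<mu> (?T x)) (arr G p (\<mu> (?T x)) u)"
        using functor_comp[OF G pQ curve[OF Tx] midQ[OF Tx] _ curve_mid[OF Tx] u] pTx by simp
      also have "\<dots> = coproj (\<gamma> (?T (?T x))) p u"
        by (rule coproj_arr[OF pTTx mid_below[OF Tx] Rp u])
      also have "\<dots> = arr ?L (\<gamma> x) (\<gamma> (?T (?T x))) (coproj (\<gamma> x) p u)"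
        by (rule lan_arr_coproj[OF curve[OF x] curve[OF TTx] R p u, symmetric])
      finally show "?\<Phi> (?T x) (?\<Psi> x (coproj (\<gamma> x) p u)) =
          arr ?L (\<gamma> x) (\<gamma> (?T (?T x))) (coproj (\<gamma> x) p u)" .
    qed
    then show ?thesis by (simp add: shift_shift x)
  qed
  show ?thesis
    unfolding interleaving_def nat_trans_def
    using \<epsilon> precompose_functor[OF G] precompose_functor[OF lan_functor]
      lin\<Phi> lin\<Psi> nat\<Phi> nat\<Psi> \<Psi>\<Phi> \<Phi>\<Psi>
    by (simp add: precompose_def)
qed

text \<open>
  The forward map lands in the center extension since \<open>G(\<gamma> x) \<rightarrow> G(\<gamma> (x + \<epsilon>))\<close> factors through the
  sampled point \<open>\<mu> x\<close>, hence through the counit of the left extension.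
\<close>

lemma
  assumes x: "x \<in> X"
  shows ran_forward_linear:
      "linear_map K (ob G (\<gamma> x)) (ob (ran I R G) (\<gamma> (shift X \<epsilon> x)))
        (\<lambda>u. unit (\<gamma> (shift X \<epsilon> x)) (arr G (\<gamma> x) (\<gamma> (shift X \<epsilon> x)) u))"
    and ran_forward_in_cen: "u \<in> carrier (ob G (\<gamma> x)) \<Longrightarrow>
      unit (\<gamma> (shift X \<epsilon> x)) (arr G (\<gamma> x) (\<gamma> (shift X \<epsilon> x)) u)
        \<in> carrier (ob (cen K I R G) (\<gamma> (shift X \<epsilon> x)))"
    and ran_backward_linear:
      "linear_map K (ob (ran I R G) (\<gamma> x)) (ob G (\<gamma> (shift X \<epsilon> x)))
        (\<lambda>f. arr G (\<mu> x) (\<gamma> (shift X \<epsilon> x)) (f (\<mu> x)))"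
proof -
  let ?y = "\<gamma> (shift X \<epsilon> x)"
  have y: "?y \<in> Q" using x by (simp add: curve shift_closed)
  show "linear_map K (ob G (\<gamma> x)) (ob (ran I R G) ?y) (\<lambda>u. unit ?y (arr G (\<gamma> x) ?y u))"
    by (rule linear_map_comp[OF G_arr linear_map_unit]) (simp_all add: x y curve curve_shift)
  show "linear_map K (ob (ran I R G) (\<gamma> x)) (ob G ?y) (\<lambda>f. arr G (\<mu> x) ?y (f (\<mu> x)))"
    by (rule linear_map_comp[OF linear_map_ran_eval[OF mid_above[OF x]] G_arr])
      (simp_all add: x y midQ mid_curve)
  assume u: "u \<in> carrier (ob G (\<gamma> x))"
  have v: "arr G (\<gamma> x) (\<mu> x) u \<in> carrier (ob G (\<mu> x))"
    by (rule G_closed) (simp_all add: x u curve midQ curve_mid)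
  have "counit ?y (coproj ?y (\<mu> x) (arr G (\<gamma> x) (\<mu> x) u)) = arr G (\<gamma> x) ?y u"
    using functor_comp[OF G curve[OF x] midQ[OF x] y curve_mid[OF x] mid_curve[OF x] u]
    by (simp add: counit_coproj[OF y mid_below[OF x] v])
  then have "unit ?y (arr G (\<gamma> x) ?y u) =
      lan_to_ran I R G ?y (coproj ?y (\<mu> x) (arr G (\<gamma> x) (\<mu> x) u))"
    using linear_map_closed[OF linear_map_coproj[OF mid_below[OF x]] v] y
    by (simp add: lan_to_ran_eq)
  then show "unit ?y (arr G (\<gamma> x) ?y u) \<in> carrier (ob (cen K I R G) ?y)"
    using linear_map_closed[OF linear_map_coproj[OF mid_below[OF x]] v] by (simp add: cen_ob)
qed

text \<open>
  Dual to the left extension: a compatible family on \<open>above (\<gamma> x)\<close> is determined on the smaller set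
  \<open>above (\<gamma> (x + 2\<epsilon>))\<close> by its value at the sampled point \<open>\<mu> x\<close>, which lies below all of that set.
\<close>

lemma ran_interleaving:
  "interleaving K X \<epsilon> (precompose G \<gamma>) (precompose (ran I R G) \<gamma>)
    (\<lambda>x u. unit (\<gamma> (shift X \<epsilon> x)) (arr G (\<gamma> x) (\<gamma> (shift X \<epsilon> x)) u))
    (\<lambda>x f. arr G (\<mu> x) (\<gamma> (shift X \<epsilon> x)) (f (\<mu> x)))"
  (is "interleaving _ _ _ ?U ?V ?\<Phi> ?\<Psi>")
proof -
  let ?T = "shift X \<epsilon>" and ?L = "ran I R G"
  note Q = curve midQ shift_closed
  have nat\<Phi>: "?\<Phi> y (arr G (\<gamma> x) (\<gamma> y) u) = arr ?L (\<gamma> (?T x)) (\<gamma> (?T y)) (?\<Phi> x u)"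
    if x: "x \<in> X" and y: "y \<in> X" and xy: "x \<le> y" and u: "u \<in> carrier (ob G (\<gamma> x))" for x y u
  proof -
    have v: "arr G (\<gamma> x) (\<gamma> (?T x)) u \<in> carrier (ob G (\<gamma> (?T x)))"
      by (rule G_closed) (simp_all add: x u Q curve_shift)
    have "arr G (\<gamma> y) (\<gamma> (?T y)) (arr G (\<gamma> x) (\<gamma> y) u) =
        arr G (\<gamma> (?T x)) (\<gamma> (?T y)) (arr G (\<gamma> x) (\<gamma> (?T x)) u)"
      by (rule G_square) (simp_all add: x y u Q curve_mono xy curve_shift shift_mono)
    then show ?thesis
      using unit_arr[OF _ _ _ v, of "\<gamma> (?T y)"] x y xy by (simp add: Q curve_mono shift_mono)
  qed
  have nat\<Psi>: "?\<Psi> y (arr ?L (\<gamma> x) (\<gamma> y) f) = arr G (\<gamma> (?T x)) (\<gamma> (?T y)) (?\<Psi> x f)"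
    if x: "x \<in> X" and y: "y \<in> X" and xy: "x \<le> y" and f: "f \<in> carrier (ob ?L (\<gamma> x))" for x y f
  proof -
    have v: "f (\<mu> x) \<in> carrier (ob G (\<mu> x))"
      by (rule linear_map_closed[OF linear_map_ran_eval[OF mid_above[OF x]] f])
    have my: "\<mu> y \<in> above (\<gamma> x)"
      by (rule above_mono[OF mid_above[OF y] curve[OF x] curve[OF y] curve_mono[OF x y xy]])
    have "arr ?L (\<gamma> x) (\<gamma> y) f (\<mu> y) = arr G (\<mu> x) (\<mu> y) (f (\<mu> x))"
      using mid_above[OF y] ran_compatible[OF f mid_above[OF x] my mid_mono[OF x y xy]]
      by (simp add: ran_arr)
    then have "?\<Psi> y (arr ?L (\<gamma> x) (\<gamma> y) f) =
        arr G (\<mu> y) (\<gamma> (?T y)) (arr G (\<mu> x) (\<mu> y) (f (\<mu> x)))" by simp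
    also have "\<dots> = arr G (\<gamma> (?T x)) (\<gamma> (?T y)) (?\<Psi> x f)"
      by (rule G_square) (simp_all add: x y v Q curve_mono xy mid_curve mid_mono shift_mono)
    finally show ?thesis .
  qed
  have \<Psi>\<Phi>: "?\<Psi> (?T x) (?\<Phi> x u) = arr G (\<gamma> x) (\<gamma> (shift X (2 * \<epsilon>) x)) u"
    if x: "x \<in> X" and u: "u \<in> carrier (ob G (\<gamma> x))" for x u
  proof -
    have Tx: "?T x \<in> X" using x by (simp add: shift_closed)
    have v: "arr G (\<gamma> x) (\<gamma> (?T x)) u \<in> carrier (ob G (\<gamma> (?T x)))"
      by (rule G_closed) (simp_all add: x u Q curve_shift)
    have "?\<Phi> x u (\<mu> (?T x)) = arr G (\<gamma> (?T x)) (\<mu> (?T x)) (arr G (\<gamma> x) (\<gamma> (?T x)) u)"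
      using mid_above[OF Tx] by (simp add: unit_def)
    then have "?\<Psi> (?T x) (?\<Phi> x u) = arr G (\<mu> (?T x)) (\<gamma> (?T (?T x)))
        (arr G (\<gamma> (?T x)) (\<mu> (?T x)) (arr G (\<gamma> x) (\<gamma> (?T x)) u))" by simp
    also have "\<dots> = arr G (\<gamma> (?T x)) (\<gamma> (?T (?T x))) (arr G (\<gamma> x) (\<gamma> (?T x)) u)"
      by (rule functor_comp[OF G]) (simp_all add: Tx v Q curve_mid mid_curve)
    also have "\<dots> = arr G (\<gamma> x) (\<gamma> (?T (?T x))) u"
      by (rule functor_comp[OF G]) (simp_all add: x u Q curve_shift)
    finally show ?thesis by (simp add: shift_shift x)
  qed
  have \<Phi>\<Psi>: "?\<Phi> (?T x) (?\<Psi> x f) = arr ?L (\<gamma> x) (\<gamma> (shift X (2 * \<epsilon>) x)) f"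
    if x: "x \<in> X" and f: "f \<in> carrier (ob ?L (\<gamma> x))" for x f
  proof -
    have Tx: "?T x \<in> X" and TTx: "?T (?T x) \<in> X" using x by (simp_all add: shift_closed)
    have v: "f (\<mu> x) \<in> carrier (ob G (\<mu> x))"
      by (rule linear_map_closed[OF linear_map_ran_eval[OF mid_above[OF x]] f])
    have w: "arr G (\<mu> x) (\<gamma> (?T x)) (f (\<mu> x)) \<in> carrier (ob G (\<gamma> (?T x)))"
      by (rule G_closed) (simp_all add: x v Q mid_curve)
    have "arr G (\<gamma> (?T (?T x))) p (arr G (\<gamma> (?T x)) (\<gamma> (?T (?T x))) (?\<Psi> x f)) = f p"
      if p: "p \<in> above (\<gamma> (?T (?T x)))" for p
    proof -
      have pQ: "p \<in> Q" using p I by auto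
      have pTx: "p \<in> above (\<gamma> (?T x))"
        by (rule above_mono[OF p curve[OF Tx] curve[OF TTx] curve_shift[OF Tx]])
      have px: "p \<in> above (\<gamma> x)"
        by (rule above_mono[OF pTx curve[OF x] curve[OF Tx] curve_shift[OF x]])
      have mp: "R (\<mu> x) p"
        using trans[OF midQ[OF x] curve[OF Tx] pQ mid_curve[OF x]] pTx by simp
      have "arr G (\<gamma> (?T (?T x))) p (arr G (\<gamma> (?T x)) (\<gamma> (?T (?T x))) (?\<Psi> x f)) =
          arr G (\<gamma> (?T x)) p (?\<Psi> x f)"
        by (rule functor_comp[OF G]) (use p pQ in \<open>simp_all add: x w Q curve_shift\<close>)
      also have "\<dots> = arr G (\<mu> x) p (f (\<mu> x))"
        by (rule functor_comp[OF G]) (use pTx pQ in \<open>simp_all add: x v Q mid_curve\<close>)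
      also have "\<dots> = f p"
        by (rule ran_compatible[OF f mid_above[OF x] px mp])
      finally show ?thesis .
    qed
    then have "?\<Phi> (?T x) (?\<Psi> x f) = restrict f (above (\<gamma> (?T (?T x))))"
      unfolding unit_def by (intro restrict_ext) blast
    then show ?thesis by (simp add: ran_arr shift_shift x)
  qed
  show ?thesis
    unfolding interleaving_def nat_trans_def
    using \<epsilon> precompose_functor[OF G] precompose_functor[OF ran_functor]
      ran_forward_linear ran_backward_linear nat\<Phi> nat\<Psi> \<Psi>\<Phi> \<Phi>\<Psi>
    by (simp add: precompose_def)
qed

text \<open>
  The equations hold already in the right extension, so only the ranges of the maps have to be
  checked.
\<close>

lemma cen_interleaving:
  "interleaving K X \<epsilon> (precompose G \<gamma>) (precompose (cen K I R G) \<gamma>)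
    (\<lambda>x u. unit (\<gamma> (shift X \<epsilon> x)) (arr G (\<gamma> x) (\<gamma> (shift X \<epsilon> x)) u))
    (\<lambda>x f. arr G (\<mu> x) (\<gamma> (shift X \<epsilon> x)) (f (\<mu> x)))"
proof -
  have "linear_map K (ob G (\<gamma> x)) (ob (cen K I R G) (\<gamma> (shift X \<epsilon> x)))
        (\<lambda>u. unit (\<gamma> (shift X \<epsilon> x)) (arr G (\<gamma> x) (\<gamma> (shift X \<epsilon> x)) u))" if "x \<in> X" for x
    using that
    by (intro linear_map_into_cen ran_forward_linear ran_forward_in_cen curve shift_closed)
  moreover have "linear_map K (ob (cen K I R G) (\<gamma> x)) (ob G (\<gamma> (shift X \<epsilon> x)))
        (\<lambda>f. arr G (\<mu> x) (\<gamma> (shift X \<epsilon> x)) (f (\<mu> x)))" if "x \<in> X" for x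
    using that by (intro linear_map_on_cen ran_backward_linear curve)
  moreover have "f \<in> carrier (ob (ran I R G) (\<gamma> x))"
    if "x \<in> X" "f \<in> carrier (ob (cen K I R G) (\<gamma> x))" for x f
    using that by (intro cen_subset curve)
  ultimately show ?thesis
    using ran_interleaving precompose_functor[OF cen_functor]
    unfolding interleaving_def nat_trans_def
    by (simp add: precompose_def cen_arr)
qed

end


section \<open>Heights of points in the unit ball\<close>

lemma dot_commute: "dot d x y = dot d y x"
  by (simp add: dot_def mult.commute)

lemma dot_lincomb: "dot d (\<lambda>i. a * x i + b * y i) z = a * dot d x z + b * dot d y z"
  by (simp add: dot_def sum.distrib sum_distrib_left algebra_simps)

lemma dot_self: "dot d x x = (L2_set x {..<d})\<^sup>2"
  by (simp add: dot_def L2_set_def sum_nonneg power2_eq_square)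

lemma dot_le_norms: "dot d x y \<le> L2_set x {..<d} * L2_set y {..<d}"
proof -
  have "dot d x y \<le> (\<Sum>i<d. \<bar>x i\<bar> * \<bar>y i\<bar>)"
    unfolding dot_def by (intro sum_mono) (simp flip: abs_mult)
  also have "\<dots> \<le> L2_set x {..<d} * L2_set y {..<d}" by (rule L2_set_mult_ineq)
  finally show ?thesis .
qed

lemma dot_ball_le:
  assumes "L2_set x {..<d} \<le> 1"
  shows "dot d x y \<le> L2_set y {..<d}"
  using dot_le_norms[of d x y] mult_right_mono[OF assms, of "L2_set y {..<d}"] by simp

lemma
  assumes "v \<in> unit_sphere d"
  shows sphere_norm: "L2_set v {..<d} = 1" and sphere_dot_self: "dot d v v = 1"
  using assms by (simp_all add: unit_sphere_def dot_self)

lemma sphere_dot_bounds: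
  assumes v: "v \<in> unit_sphere d" and w: "w \<in> unit_sphere d"
  shows "-1 \<le> dot d v w" "dot d v w \<le> 1"
proof -
  show "dot d v w \<le> 1" using dot_le_norms[of d v w] by (simp add: sphere_norm[OF v] sphere_norm[OF w])
  have "- dot d v w = dot d (\<lambda>i. - 1 * v i + 0 * v i) w"
    by (subst dot_lincomb) simp
  also have "\<dots> \<le> L2_set w {..<d}"
    using sphere_norm[OF v] by (intro dot_ball_le) (simp add: L2_set_def)
  finally show "-1 \<le> dot d v w" by (simp add: sphere_norm[OF w])
qed

lemma dot_diff_le_dist:
  assumes "L2_set x {..<d} \<le> 1"
  shows "dot d x w \<le> dot d x v + dist_l2 d v w"
proof -
  have "dot d x w - dot d x v = dot d (\<lambda>i. - 1 * v i + 1 * w i) x"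
    by (subst dot_lincomb) (simp add: dot_commute)
  also have "\<dots> = dot d x (\<lambda>i. - 1 * v i + 1 * w i)" by (rule dot_commute)
  also have "\<dots> \<le> L2_set (\<lambda>i. - 1 * v i + 1 * w i) {..<d}" by (rule dot_ball_le[OF assms])
  also have "\<dots> = dist_l2 d v w" by (simp add: dist_l2_def L2_set_def power2_commute)
  finally show ?thesis by simp
qed

lemma dist_geo_bounds:
  assumes "v \<in> unit_sphere d" "w \<in> unit_sphere d"
  shows "0 \<le> dist_geo d v w" "dist_geo d v w \<le> pi" "cos (dist_geo d v w) = dot d v w"
  using sphere_dot_bounds[OF assms] by (simp_all add: dist_geo_def arccos_lbound arccos_ubound)

text \<open>
  On the unit ball cut off by \<open>x \<bullet> v \<le> cos a\<close>, the height in direction \<open>w\<close> is maximal at the point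
  \<open>y\<close> of the sphere that lies beyond \<open>w\<close> on the great circle from \<open>v\<close>, at angle \<open>a\<close> from \<open>v\<close>.
  As \<open>w\<close> lies on the arc from \<open>v\<close> to \<open>y\<close>, it is a nonnegative combination of both, namely
  \<open>sin a \<cdot> w = sin (a - \<theta>) \<cdot> v + sin \<theta> \<cdot> y\<close>. The vector \<open>z\<close> below is \<open>sin \<theta> \<cdot> y\<close>.
\<close>

lemma height_in_cap_le:
  assumes v: "v \<in> unit_sphere d" and w: "w \<in> unit_sphere d" and x: "L2_set x {..<d} \<le> 1"
    and a: "dist_geo d v w \<le> a" "a \<le> pi" and xv: "dot d x v \<le> cos a"
  shows "dot d x w \<le> cos (a - dist_geo d v w)"
proof -
  define \<theta> where "\<theta> = dist_geo d v w"
  have \<theta>: "0 \<le> \<theta>" "\<theta> \<le> pi" "cos \<theta> = dot d v w"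
    using dist_geo_bounds[OF v w] by (simp_all add: \<theta>_def)
  have a0: "0 \<le> a" and le: "\<theta> \<le> a" using a \<theta> by (simp_all add: \<theta>_def)
  consider "a = 0" | "a = pi" | "0 < a" "a < pi" using a0 a by linarith
  then show ?thesis
  proof cases
    case 1
    then show ?thesis using \<theta> le dot_ball_le[OF x, of w] by (simp add: sphere_norm[OF w] flip: \<theta>_def)
  next
    \<comment> \<open>Here \<open>x\<close> can only be \<open>- v\<close>.\<close>
    case 2
    define u where "u = (\<lambda>i. 1 * x i + 1 * v i)"
    have "(L2_set u {..<d})\<^sup>2 = dot d x x + 2 * dot d x v + dot d v v"
      unfolding dot_self[symmetric] u_def
      by (simp add: dot_def sum.distrib sum_distrib_left algebra_simps)
    also have "\<dots> \<le> 0"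
      using xv 2 power_mono[OF x L2_set_nonneg, of 2] by (simp add: dot_self sphere_norm[OF v])
    finally have "L2_set u {..<d} = 0" by simp
    then have "dot d u w \<le> 0" using dot_le_norms[of d u w] by simp
    then have "dot d x w \<le> - cos \<theta>" unfolding u_def dot_lincomb \<theta> by simp
    then show ?thesis using 2 by (simp flip: \<theta>_def)
  next
    case 3
    have s: "0 < sin a" using 3 by (intro sin_gt_zero) auto
    define b where "b = sin (a - \<theta>)"
    have b: "0 \<le> b" unfolding b_def using le a \<theta> by (intro sin_ge_zero) auto
    define z where "z = (\<lambda>i. sin a * w i + (- b) * v i)"
    have "(L2_set z {..<d})\<^sup>2 = (sin a)\<^sup>2 * dot d w w - 2 * sin a * b * dot d v w + b\<^sup>2 * dot d v v"
      unfolding dot_self[symmetric] z_def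
      by (simp add: dot_def sum.distrib sum_distrib_left sum_subtractf algebra_simps power2_eq_square)
    also have "\<dots> = (sin a)\<^sup>2 - 2 * sin a * b * cos \<theta> + b\<^sup>2"
      by (simp add: sphere_dot_self[OF v] sphere_dot_self[OF w] \<theta>)
    also have "\<dots> = (sin \<theta>)\<^sup>2"
    proof -
      have "(sin a)\<^sup>2 - 2 * sin a * b * cos \<theta> + b\<^sup>2 =
          (sin a)\<^sup>2 + (cos a)\<^sup>2 * (sin \<theta>)\<^sup>2 - (sin a)\<^sup>2 * (cos \<theta>)\<^sup>2"
        unfolding b_def sin_diff by (simp add: algebra_simps power2_eq_square)
      also have "\<dots> = (sin \<theta>)\<^sup>2"
        unfolding cos_squared_eq by (simp add: algebra_simps)
      finally show ?thesis .
    qed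
    finally have "L2_set z {..<d} = sin \<theta>"
      using sin_ge_zero[OF \<theta>(1,2)] by (simp add: power2_eq_iff_nonneg)
    then have z: "dot d x z \<le> sin \<theta>" using dot_ball_le[OF x, of z] by simp
    have "sin a * dot d x w = b * dot d x v + dot d x z"
      using dot_lincomb[of d "sin a" w "- b" v x] by (simp add: z_def dot_commute[of d x])
    also have "\<dots> \<le> b * cos a + sin \<theta>" using z mult_left_mono[OF xv b] by simp
    also have "\<dots> = sin a * cos (a - \<theta>)"
    proof -
      have "sin \<theta> = sin (a - (a - \<theta>))" by simp
      also have "\<dots> = sin a * cos (a - \<theta>) - cos a * b" unfolding b_def by (rule sin_diff)
      finally show ?thesis by simp
    qed
    finally show ?thesis using s by (simp flip: \<theta>_def)
  qed
qed

text \<open>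
  Take \<open>u\<close> itself as the point of the ball, with \<open>a\<close> its angle from \<open>v\<close>: the bound on its height in
  direction \<open>w\<close> says that its angle from \<open>w\<close> is at least \<open>a - \<theta>\<close>.
\<close>

lemma dist_geo_triangle:
  assumes v: "v \<in> unit_sphere d" and w: "w \<in> unit_sphere d" and u: "u \<in> unit_sphere d"
  shows "dist_geo d v u \<le> dist_geo d v w + dist_geo d w u"
proof (cases "dist_geo d v w \<le> dist_geo d v u")
  case True
  have "dot d u w \<le> cos (dist_geo d v u - dist_geo d v w)"
    using dist_geo_bounds[OF v u] True
    by (intro height_in_cap_le[OF v w]) (simp_all add: sphere_norm[OF u] dot_commute)
  then have "arccos (cos (dist_geo d v u - dist_geo d v w)) \<le> arccos (dot d u w)"
    using sphere_dot_bounds[OF u w] by (intro arccos_le_arccos) auto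
  moreover have "arccos (cos (dist_geo d v u - dist_geo d v w)) = dist_geo d v u - dist_geo d v w"
    using True dist_geo_bounds[OF v u] dist_geo_bounds[OF v w] by (intro arccos_cos) auto
  ultimately show ?thesis by (simp add: dist_geo_def dot_commute)
next
  case False
  then show ?thesis using dist_geo_bounds[OF w u] by simp
qed


section \<open>Space-time of a set of directions\<close>

text \<open>
  What the linear and the angular parametrization have in common: space-time is a preorder on which
  the sublevel sets of \<open>M\<close> increase.
\<close>

locale spacetime =
  fixes d :: nat and M :: "(nat \<Rightarrow> real) set" and X :: "real set"
    and \<delta> :: "(nat \<Rightarrow> real) \<Rightarrow> (nat \<Rightarrow> real) \<Rightarrow> real" and h :: "real \<Rightarrow> real"
  assumes interval: "\<exists>a b. a \<le> b \<and> X = {a..b}"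
    and dist_refl: "v \<in> unit_sphere d \<Longrightarrow> \<delta> v v = 0"
    and dist_nonneg: "\<lbrakk>v \<in> unit_sphere d; w \<in> unit_sphere d\<rbrakk> \<Longrightarrow> 0 \<le> \<delta> v w"
    and dist_sym: "\<delta> v w = \<delta> w v"
    and dist_triangle: "\<lbrakk>v \<in> unit_sphere d; w \<in> unit_sphere d; u \<in> unit_sphere d\<rbrakk>
      \<Longrightarrow> \<delta> v u \<le> \<delta> v w + \<delta> w u"
    and sublevel_mono: "\<lbrakk>v \<in> unit_sphere d; w \<in> unit_sphere d; \<alpha> \<in> X; \<beta> \<in> X; \<alpha> + \<delta> v w \<le> \<beta>; x \<in> M;
      dot d x v \<le> h \<alpha>\<rbrakk> \<Longrightarrow> dot d x w \<le> h \<beta>"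
    and sublevel_top: "\<lbrakk>w \<in> unit_sphere d; x \<in> M\<rbrakk> \<Longrightarrow> dot d x w \<le> h (Sup X)"
begin

abbreviation "events \<equiv> unit_sphere d \<times> X"

lemma le_Sup: "x \<in> X \<Longrightarrow> x \<le> Sup X"
  using interval by auto

lemma shift_in: "\<lbrakk>x \<in> X; 0 \<le> \<epsilon>\<rbrakk> \<Longrightarrow> shift X \<epsilon> x \<in> X"
  using interval by (auto simp: shift_def)

lemma spacetime_refl: "p \<in> events \<Longrightarrow> spacetime_le X \<delta> p p"
  by (auto simp: spacetime_le_def dist_refl)

lemma spacetime_trans:
  assumes "p \<in> events" "q \<in> events" "r \<in> events"
    and "spacetime_le X \<delta> p q" "spacetime_le X \<delta> q r"
  shows "spacetime_le X \<delta> p r"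
proof -
  obtain v \<alpha> w \<beta> u \<gamma> where p: "p = (v, \<alpha>)" and q: "q = (w, \<beta>)" and r: "r = (u, \<gamma>)"
    by (metis surj_pair)
  have "\<delta> v u \<le> \<delta> v w + \<delta> w u" "0 \<le> \<delta> w u"
    using assms by (simp_all add: p q r dist_triangle dist_nonneg)
  then show ?thesis
    using assms le_Sup[of \<gamma>] by (auto simp: p q r spacetime_le_def)
qed

lemma sublevel_inclusion:
  assumes "(v, \<alpha>) \<in> events" "(w, \<beta>) \<in> events" "spacetime_le X \<delta> (v, \<alpha>) (w, \<beta>)"
  shows "continuous_map (sublevel d M v (h \<alpha>)) (sublevel d M w (h \<beta>)) id"
proof -
  have "{x \<in> M. dot d x v \<le> h \<alpha>} \<subseteq> {x \<in> M. dot d x w \<le> h \<beta>}"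
    using assms sublevel_mono[of v w \<alpha> \<beta>] sublevel_top[of w] by (auto simp: spacetime_le_def)
  then show ?thesis
    unfolding sublevel_def
    by (auto simp: continuous_map_in_subtopology continuous_map_from_subtopology)
qed

lemma spacetime_pht_functor:
  assumes K: "field K"
  shows "vect_functor K events (spacetime_le X \<delta>) (spacetime_pht K d h n M)"
proof (rule vect_functorI)
  fix p assume "p \<in> events"
  then show "vectorspace K (ob (spacetime_pht K d h n M) p)"
    by (auto simp: spacetime_pht_def pht_def vectorspace_homology[OF K])
next
  fix p q assume "p \<in> events" "q \<in> events" "spacetime_le X \<delta> p q"
  then show "linear_map K (ob (spacetime_pht K d h n M) p) (ob (spacetime_pht K d h n M) q)
      (arr (spacetime_pht K d h n M) p q)"
    by (cases p; cases q)
      (simp add: spacetime_pht_def pht_def linear_map_homology_map[OF K sublevel_inclusion])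
next
  fix p x assume "p \<in> events" "x \<in> carrier (ob (spacetime_pht K d h n M) p)"
  then show "arr (spacetime_pht K d h n M) p p x = x"
    by (cases p) (simp add: spacetime_pht_def pht_def homology_map_id[OF K])
next
  fix p q r x assume "p \<in> events" "q \<in> events" "r \<in> events" "spacetime_le X \<delta> p q"
    "spacetime_le X \<delta> q r" "x \<in> carrier (ob (spacetime_pht K d h n M) p)"
  then show "arr (spacetime_pht K d h n M) q r (arr (spacetime_pht K d h n M) p q x) =
      arr (spacetime_pht K d h n M) p r x"
    by (cases p; cases q; cases r)
      (simp add: spacetime_pht_def pht_def
        homology_map_comp[OF K sublevel_inclusion sublevel_inclusion])
qed

text \<open>
  The midpoints lie half way along the shift, on the line of the sampled direction. Truncation at
  \<open>Sup X\<close> is harmless, since an event with time \<open>Sup X\<close> lies above all events.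
\<close>

lemma interpolated_curve_direction:
  assumes K: "field K" and A: "A \<subseteq> unit_sphere d" and w: "w \<in> unit_sphere d" and v: "v \<in> A"
  shows "interpolated_curve K events (A \<times> X) (spacetime_le X \<delta>) (spacetime_pht K d h n M) X
    (2 * \<delta> v w) (Pair w) (\<lambda>x. (v, shift X (\<delta> v w) x))"
proof (intro interpolated_curve.intro kan_extension.intro interpolated_curve_axioms.intro)
  have vs: "v \<in> unit_sphere d" using v A by auto
  have pos: "0 \<le> \<delta> v w" by (rule dist_nonneg[OF vs w])
  show "field K" "vect_functor K events (spacetime_le X \<delta>) (spacetime_pht K d h n M)"
    "A \<times> X \<subseteq> events" "0 \<le> 2 * \<delta> v w"
    using K A pos by (auto simp: spacetime_pht_functor)
  show "spacetime_le X \<delta> p p" if "p \<in> events" for p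
    using that by (rule spacetime_refl)
  show "spacetime_le X \<delta> p r" if "p \<in> events" "q \<in> events" "r \<in> events" "spacetime_le X \<delta> p q"
    "spacetime_le X \<delta> q r" for p q r
    using that by (rule spacetime_trans)
  fix x assume x: "x \<in> X"
  show "shift X (2 * \<delta> v w) x \<in> X" using x pos by (simp add: shift_in)
  show "shift X (2 * \<delta> v w) (shift X (2 * \<delta> v w) x) = shift X (2 * (2 * \<delta> v w)) x"
    using pos by (simp add: shift_def)
  show "(w, x) \<in> events" using w x by simp
  show "(v, shift X (\<delta> v w) x) \<in> A \<times> X" using v x pos by (simp add: shift_in)
  show "spacetime_le X \<delta> (w, x) (v, shift X (\<delta> v w) x)"
    by (auto simp: spacetime_le_def shift_def dist_sym[of w v])
  show "spacetime_le X \<delta> (v, shift X (\<delta> v w) x) (w, shift X (2 * \<delta> v w) x)"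
    using pos by (auto simp: spacetime_le_def shift_def)
  fix y assume "y \<in> X" "x \<le> y"
  then show "spacetime_le X \<delta> (w, x) (w, y)"
    "spacetime_le X \<delta> (v, shift X (\<delta> v w) x) (v, shift X (\<delta> v w) y)"
    by (auto simp: spacetime_le_def shift_def dist_refl w vs)
qed

lemma pht_spacetime_slice: "pht K d h n M w = precompose (spacetime_pht K d h n M) (Pair w)"
  by (simp add: pht_def spacetime_pht_def precompose_def)

end

section \<open>The two parametrizations\<close>

lemma spacetime_l2:
  assumes M: "M \<subseteq> unit_ball d"
  shows "spacetime d M {-1..1} (dist_l2 d) (\<lambda>t. t)"
proof
  have ball: "L2_set x {..<d} \<le> 1" if "x \<in> M" for x using that M by (auto simp: unit_ball_def)
  show "\<exists>a b. a \<le> b \<and> {-1..1 :: real} = {a..b}" by (intro exI[of _ "-1"] exI[of _ 1]) simp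
  show "dist_l2 d v v = 0" for v by (simp add: dist_l2_def L2_set_def)
  show "0 \<le> dist_l2 d v w" for v w by (simp add: dist_l2_def)
  show "dist_l2 d v w = dist_l2 d w v" for v w
    by (simp add: dist_l2_def L2_set_def power2_commute)
  show "dist_l2 d v u \<le> dist_l2 d v w + dist_l2 d w u" for v w u
    using L2_set_triangle_ineq[of "\<lambda>i. v i - w i" "\<lambda>i. w i - u i" "{..<d}"]
    by (simp add: dist_l2_def)
  show "dot d x w \<le> \<beta>" if "\<alpha> + dist_l2 d v w \<le> \<beta>" "x \<in> M" "dot d x v \<le> \<alpha>" for v w \<alpha> \<beta> x
    using dot_diff_le_dist[OF ball[OF that(2)], of w v] that by simp
  show "dot d x w \<le> Sup {-1..1}" if "w \<in> unit_sphere d" "x \<in> M" for w x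
    using dot_ball_le[OF ball[OF that(2)], of w] by (simp add: sphere_norm[OF that(1)])
qed

lemma spacetime_geo:
  assumes M: "M \<subseteq> unit_ball d"
  shows "spacetime d M {-pi..0} (dist_geo d) cos"
proof
  have ball: "L2_set x {..<d} \<le> 1" if "x \<in> M" for x using that M by (auto simp: unit_ball_def)
  show "\<exists>a b. a \<le> b \<and> {-pi..0} = {a..b}" by (intro exI[of _ "-pi"] exI[of _ 0]) simp
  show "dist_geo d v v = 0" if "v \<in> unit_sphere d" for v
    using that by (simp add: dist_geo_def sphere_dot_self)
  show "0 \<le> dist_geo d v w" if "v \<in> unit_sphere d" "w \<in> unit_sphere d" for v w
    using that by (rule dist_geo_bounds)
  show "dist_geo d v w = dist_geo d w v" for v w by (simp add: dist_geo_def dot_commute)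
  show "dist_geo d v u \<le> dist_geo d v w + dist_geo d w u"
    if "v \<in> unit_sphere d" "w \<in> unit_sphere d" "u \<in> unit_sphere d" for v w u
    using that by (rule dist_geo_triangle)
  show "dot d x w \<le> cos \<beta>"
    if vw: "v \<in> unit_sphere d" "w \<in> unit_sphere d" and \<alpha>\<beta>: "\<alpha> \<in> {-pi..0}" "\<beta> \<in> {-pi..0}"
      and le: "\<alpha> + dist_geo d v w \<le> \<beta>" and x: "x \<in> M" "dot d x v \<le> cos \<alpha>" for v w \<alpha> \<beta> x
  proof -
    have "dot d x w \<le> cos (- \<alpha> - dist_geo d v w)"
      using \<alpha>\<beta> le x by (intro height_in_cap_le[OF vw ball]) auto
    also have "\<dots> = cos (\<alpha> + dist_geo d v w)"
      using cos_minus[of "\<alpha> + dist_geo d v w"] by simp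
    also have "\<dots> \<le> cos \<beta>"
      using cos_monotone_minus_pi_0'[of "\<alpha> + dist_geo d v w" \<beta>] le \<alpha>\<beta> dist_geo_bounds[OF vw]
      by simp
    finally show ?thesis .
  qed
  show "dot d x w \<le> cos (Sup {-pi..0})" if "w \<in> unit_sphere d" "x \<in> M" for w x
    using dot_ball_le[OF ball[OF that(2)], of w] by (simp add: sphere_norm[OF that(1)])
qed

section \<open>Interleaving with the Kan extensions of the sampled transform\<close>

theorem lemma4p1:
  fixes K :: "('k, 'm) ring_scheme"
    and \<O> :: "nat \<Rightarrow> (nat \<Rightarrow> real) set set"
    and d n :: nat
    and M A :: "(nat \<Rightarrow> real) set"
    and X :: "real set"
    and \<delta> :: "(nat \<Rightarrow> real) \<Rightarrow> (nat \<Rightarrow> real) \<Rightarrow> real"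
    and h :: "real \<Rightarrow> real"
    and v w :: "nat \<Rightarrow> real"
  assumes "field K"
    and "o_minimal \<O>"
    and "constructible \<O> d M"
    and "M \<subseteq> unit_ball d"
    and "(X, \<delta>, h) = ({-1..1}, dist_l2 d, \<lambda>t. t) \<or> (X, \<delta>, h) = ({-pi..0}, dist_geo d, cos)"
    and "A \<subseteq> unit_sphere d"
    and "w \<in> unit_sphere d"
    and "v \<in> A"
  shows "(\<exists>\<Phi> \<Psi>. interleaving K X (2 * \<delta> v w) (pht K d h n M w) (pht_left K d X \<delta> h A n M w) \<Phi> \<Psi>) \<and>
    (\<exists>\<Phi> \<Psi>. interleaving K X (2 * \<delta> v w) (pht K d h n M w) (pht_right K d X \<delta> h A n M w) \<Phi> \<Psi>) \<and>
    (\<exists>\<Phi> \<Psi>. interleaving K X (2 * \<delta> v w) (pht K d h n M w) (pht_center K d X \<delta> h A n M w) \<Phi> \<Psi>)"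
proof -
  interpret spacetime d M X \<delta> h
    using assms(5) spacetime_l2[OF assms(4)] spacetime_geo[OF assms(4)] by auto
  interpret interpolated_curve K events "A \<times> X" "spacetime_le X \<delta>" "spacetime_pht K d h n M" X
    "2 * \<delta> v w" "Pair w" "\<lambda>x. (v, shift X (\<delta> v w) x)"
    by (rule interpolated_curve_direction[OF assms(1,6-8)])
  show ?thesis
    unfolding pht_spacetime_slice pht_left_def pht_right_def pht_center_def
    using lan_interleaving ran_interleaving cen_interleaving by blast
qed

end
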